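(* Let $S^2\subset\mathbb{R}^3$ be the unit sphere, $e_3=(0,0,1)$, $\theta\in(0,\pi/2]$, $B_\theta=\{x\in S^2:x\cdot e_3>\cos\theta\}$, and let $f$ be an infinitely differentiable function on $S^2$ with $\operatorname{supp}f\subset B_\theta$. For $x\in S^2$, $t\in(-1,1)$, let $(Mf)(x,t)=\frac{(1-t^2)^{-1/2}}{2\pi}\int_{\{y\in S^2:\,x\cdot y=t\}}f(y)\,d\sigma(y)$. Then for $x=(x',x_3)\in B_\theta$, $$f(x)=\frac{x_3}{2\pi\sin\theta}\,\Delta_{x'}\int_{\partial B_\theta}\int_{-1}^1(Mf)(\xi,\tau)\log|\tau-\xi\cdot x|\,d\tau\,d\xi.$$
   Context: $d\sigma$ is arc-length measure on the circle $\{x\cdot y=t\}$ and $d\xi$ is arc-length measure on $\partial B_\theta$. Points of the upper hemisphere are written $x=(x',x_3)$ with $x'\in\mathbb{R}^2$, $x_3=\sqrt{1-|x'|^2}$, and the right-hand side is regarded as a function of $x'$; $\Delta_{x'}$ is the Laplacian in $x'$. *)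

theory Defs
  imports "HOL-Analysis.Analysis"
begin

fun Cn_on :: "nat \<Rightarrow> 'a::real_normed_vector set \<Rightarrow> ('a \<Rightarrow> real) \<Rightarrow> bool" where
  "Cn_on 0 U F = continuous_on U F"
| "Cn_on (Suc n) U F = (\<exists>F'. (\<forall>y\<in>U. (F has_derivative F' y) (at y)) \<and>
                                (\<forall>v. Cn_on n U (\<lambda>y. F' y v)))"

definition smooth_on :: "'a::real_normed_vector set \<Rightarrow> ('a \<Rightarrow> real) \<Rightarrow> bool" where
  "smooth_on U F \<longleftrightarrow> (\<forall>n. Cn_on n U F)"

definition smooth_on_sphere :: "(real^3 \<Rightarrow> real) \<Rightarrow> bool" where
  "smooth_on_sphere f \<longleftrightarrow> (\<exists>U F. open U \<and> sphere 0 1 \<subseteq> U \<and> smooth_on U F \<and>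
                                  (\<forall>y\<in>sphere 0 1. F y = f y))"

definition e3 :: "real^3" where "e3 = axis 3 1"

definition cap :: "real \<Rightarrow> (real^3) set" where
  "cap \<theta> = {x \<in> sphere 0 1. x \<bullet> e3 > cos \<theta>}"

text \<open>Arc-length integral of g over the circle with centre c, radius r, lying in the plane
  through c orthogonal to n, via an orthonormal frame (u,v) of that plane
  (the value is independent of the choice of frame).\<close>
definition circle_int :: "(real^3 \<Rightarrow> real) \<Rightarrow> real^3 \<Rightarrow> real^3 \<Rightarrow> real \<Rightarrow> real" where
  "circle_int g c n r =
     (let (u, v) = (SOME (u, v). norm u = 1 \<and> norm v = 1 \<and> u \<bullet> v = 0 \<and> u \<bullet> n = 0 \<and> v \<bullet> n = 0)
      in integral {0..2*pi} (\<lambda>\<phi>. g (c + (r * cos \<phi>) *\<^sub>R u + (r * sin \<phi>) *\<^sub>R v) * r))"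

text \<open>(Mf)(x,t): the circle {y in S^2. x.y = t} has centre t x, radius sqrt(1-t^2), normal x.\<close>
definition Mf :: "(real^3 \<Rightarrow> real) \<Rightarrow> real^3 \<Rightarrow> real \<Rightarrow> real" where
  "Mf f x t = (1 - t^2) powr (-1/2) / (2*pi) * circle_int f (t *\<^sub>R x) x (sqrt (1 - t^2))"

definition lift :: "real^2 \<Rightarrow> real^3" where
  "lift p = vector [p$1, p$2, sqrt (1 - ((p$1)^2 + (p$2)^2))]"

definition proj :: "real^3 \<Rightarrow> real^2" where
  "proj x = vector [x$1, x$2]"

definition second_partial :: "(real^2 \<Rightarrow> real) \<Rightarrow> real^2 \<Rightarrow> 2 \<Rightarrow> real \<Rightarrow> bool" where
  "second_partial G p i D \<longleftrightarrow> (\<exists>g. (\<forall>\<^sub>F s in nhds 0.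
        ((\<lambda>u. G (p + u *\<^sub>R axis i 1)) has_real_derivative g s) (at s)) \<and>
        (g has_real_derivative D) (at 0))"

definition has_laplacian :: "(real^2 \<Rightarrow> real) \<Rightarrow> real^2 \<Rightarrow> real \<Rightarrow> bool" where
  "has_laplacian G p L \<longleftrightarrow> (\<exists>D. (\<forall>i. second_partial G p i (D i)) \<and> L = (\<Sum>i\<in>UNIV. D i))"

end

theory Submission
  imports Defs
begin

text \<open>
  In the coordinates \<open>(\<tau>, \<phi>)\<close> of height and longitude about an axis \<open>\<xi>\<close>, surface measure on the sphere is
  \<open>d\<tau> d\<phi>\<close>; hence \<open>\<integral> (Mf)(\<xi>,\<tau>) ln \<bar>\<tau> - \<xi>\<bullet>x\<bar> d\<tau>\<close> is \<open>1/(2\<pi>)\<close> times the surface integral of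
  \<open>f(y) ln \<bar>\<xi>\<bullet>(y - x)\<bar>\<close>. For \<open>\<xi>\<close> on the boundary of the cap,
  \<open>\<xi>\<bullet>(y - x) = \<gamma> + \<alpha> cos t + \<beta> sin t\<close> with amplitude \<open>sin \<theta> \<bar>y' - x'\<bar>\<close>, and \<open>\<bar>\<gamma>\<bar>\<close> does not exceed
  the amplitude when \<open>x\<close> and \<open>y\<close> lie in the cap. Such an expression factors into two sines of half angles,
  so the mean of its logarithm is the logarithm of the amplitude plus a constant.
  After Fubini, the backprojection is therefore \<open>sin \<theta>\<close> times the planar logarithmic potential of
  \<open>f(y)/y\<^sub>3\<close>, up to an additive constant, and the Laplacian of the potential is \<open>2\<pi>\<close> times its density.
\<close>

section \<open>Functions of class C^n\<close>

text \<open>The factor \<open>1 / y $ 3\<close> in the density is the Jacobian of vertical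
  projection to the plane. It is the source of the weight \<open>x $ 3\<close> in the formula, and
  it calls for a cap inside the upper hemisphere, where the projection is injective. Two
  singularities shape the proof. Fubini needs absolute integrability of a logarithm that is singular
  along circles moving with \<xi>. It is drawn from the signed mean: s = |\<xi> . (y - x)| is at
  most 2, so |ln s| <= 2 ln 2 - ln s, and the exact mean over \<xi> also bounds the absolute one.
  The comparison of \<gamma> with the amplitude is decisive, because beyond it the mean of the
  logarithm would depend on \<gamma>, hence on the heights of x and y, and no planar potential would
  appear. For the Laplacian, the kernel is never differentiated. A translation moves x' into the
  density, which is smooth with compact support because the support of f is compact in the open cap.
  Both derivatives fall on the density, and polar coordinates about x' evaluate the result.\<close>

lemma Cn_on_cong:
  assumes "open U" "Cn_on n U F" "\<And>y. y \<in> U \<Longrightarrow> F y = G y"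
  shows "Cn_on n U G"
proof (cases n)
  case 0 then show ?thesis using assms by (auto cong: continuous_on_cong)
next
  case (Suc m)
  then obtain F' where F': "\<forall>y\<in>U. (F has_derivative F' y) (at y)" "\<forall>v. Cn_on m U (\<lambda>y. F' y v)"
    using assms(2) by auto
  have "\<forall>y\<in>U. (G has_derivative F' y) (at y)"
    using F'(1) assms(1,3) by (metis has_derivative_transform_within_open)
  with F'(2) Suc show ?thesis by auto
qed

lemma Cn_on_imp_continuous_on: "Cn_on n U F \<Longrightarrow> continuous_on U F"
  by (cases n)
     (auto intro: continuous_at_imp_continuous_on has_derivative_continuous)

lemma Cn_on_Suc_imp: "Cn_on (Suc n) U F \<Longrightarrow> Cn_on n U F"
proof (induction n arbitrary: F)
  case 0 show ?case using Cn_on_imp_continuous_on[OF 0] by simp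
next
  case (Suc n)
  then obtain F' where "\<forall>y\<in>U. (F has_derivative F' y) (at y)" "\<forall>v. Cn_on (Suc n) U (\<lambda>y. F' y v)"
    by (auto simp del: Cn_on.simps simp: Cn_on.simps(2)[of "Suc n"])
  with Suc.IH show ?case by auto
qed

lemma Cn_on_const: "Cn_on n U (\<lambda>_. c)"
proof (induction n arbitrary: c)
  case (Suc n) then show ?case by (auto intro!: exI[of _ "\<lambda>_ _. 0"])
qed auto

lemma Cn_on_linear:
  assumes "bounded_linear l" shows "Cn_on n U l"
proof (cases n)
  case 0 then show ?thesis using assms by (auto intro: linear_continuous_on)
next
  case (Suc m) then show ?thesis using assms
    by (auto intro!: exI[of _ "\<lambda>_. l"] Cn_on_const bounded_linear_imp_has_derivative)
qed

lemma Cn_on_add: "Cn_on n U F \<Longrightarrow> Cn_on n U G \<Longrightarrow> Cn_on n U (\<lambda>y. F y + G y)"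
proof (induction n arbitrary: F G)
  case 0 then show ?case by (auto intro: continuous_intros)
next
  case (Suc n)
  obtain F' G' where "\<forall>y\<in>U. (F has_derivative F' y) (at y)" "\<forall>v. Cn_on n U (\<lambda>y. F' y v)"
    "\<forall>y\<in>U. (G has_derivative G' y) (at y)" "\<forall>v. Cn_on n U (\<lambda>y. G' y v)"
    using Suc.prems by auto
  then show ?case
    by (auto intro!: exI[of _ "\<lambda>y v. F' y v + G' y v"] has_derivative_add Suc.IH)
qed

lemma Cn_on_sum: "(\<And>i. i \<in> I \<Longrightarrow> Cn_on n U (F i)) \<Longrightarrow> Cn_on n U (\<lambda>y. \<Sum>i\<in>I. F i y)"
  by (induction I rule: infinite_finite_induct) (auto intro: Cn_on_const Cn_on_add)

lemma Cn_on_mult: "Cn_on n U F \<Longrightarrow> Cn_on n U G \<Longrightarrow> Cn_on n U (\<lambda>y. F y * G y)"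
proof (induction n arbitrary: F G)
  case 0 then show ?case by (auto intro: continuous_intros)
next
  case (Suc n)
  obtain F' G' where FG: "\<forall>y\<in>U. (F has_derivative F' y) (at y)" "\<forall>v. Cn_on n U (\<lambda>y. F' y v)"
    "\<forall>y\<in>U. (G has_derivative G' y) (at y)" "\<forall>v. Cn_on n U (\<lambda>y. G' y v)"
    using Suc.prems by auto
  have "\<forall>y\<in>U. ((\<lambda>y. F y * G y) has_derivative (\<lambda>v. F y * G' y v + F' y v * G y)) (at y)"
    using FG by (auto intro: has_derivative_mult)
  moreover have "\<forall>v. Cn_on n U (\<lambda>y. F y * G' y v + F' y v * G y)"
    using FG Suc.prems[THEN Cn_on_Suc_imp] by (auto intro!: Cn_on_add Suc.IH)
  ultimately show ?case by auto
qed

text \<open>The chain rule, with the derivative of \<open>L\<close> expanded over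
  \<open>Basis\<close>, gives a sum of products: a derivative of \<open>F\<close> evaluated along
  \<open>L\<close>, times a derivative of a component of \<open>L\<close>. Only \<open>F\<close> has
  to be generalised in the induction, since the first factor is again a function of
  \<open>L y\<close>, of one class lower.\<close>

lemma Cn_on_compose:
  fixes F :: "'b::euclidean_space \<Rightarrow> real"
  assumes "Cn_on n V F" "L ` U \<subseteq> V" "\<And>b. b \<in> Basis \<Longrightarrow> Cn_on n U (\<lambda>y. L y \<bullet> b)"
  shows "Cn_on n U (\<lambda>y. F (L y))"
  using assms
proof (induction n arbitrary: F)
  case 0
  then have "continuous_on U L" by (auto intro: continuous_on_componentwise[THEN iffD2])
  then show ?case
    using 0 by (auto intro: continuous_on_compose2)
next
  case (Suc n)
  obtain F' where F': "\<forall>y\<in>V. (F has_derivative F' y) (at y)" "\<forall>v. Cn_on n V (\<lambda>y. F' y v)"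
    using Suc.prems(1) by auto
  have "\<forall>b\<in>Basis. \<exists>l. (\<forall>y\<in>U. ((\<lambda>y. L y \<bullet> b) has_derivative l y) (at y)) \<and> (\<forall>v. Cn_on n U (\<lambda>y. l y v))"
    using Suc.prems(3) by auto
  then obtain l where l: "\<And>b y. b \<in> Basis \<Longrightarrow> y \<in> U \<Longrightarrow> ((\<lambda>y. L y \<bullet> b) has_derivative l b y) (at y)"
     "\<And>b v. b \<in> Basis \<Longrightarrow> Cn_on n U (\<lambda>y. l b y v)"
    by metis
  have der: "((\<lambda>y. F (L y)) has_derivative (\<lambda>v. \<Sum>b\<in>Basis. F' (L y) b * l b y v)) (at y)" if "y \<in> U" for y
  proof -
    have "(L has_derivative (\<lambda>v. \<Sum>b\<in>Basis. l b y v *\<^sub>R b)) (at y)"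
      by (subst has_derivative_componentwise_within) (use l(1) that in auto)
    moreover have F'y: "(F has_derivative F' (L y)) (at (L y))"
      using F'(1) Suc.prems(2) that by auto
    ultimately have "((\<lambda>y. F (L y)) has_derivative (\<lambda>v. F' (L y) (\<Sum>b\<in>Basis. l b y v *\<^sub>R b))) (at y)"
      by (rule has_derivative_compose)
    moreover have "linear (F' (L y))"
      using F'y by (rule has_derivative_linear)
    ultimately show ?thesis
      by (simp add: linear_sum linear_cmul mult.commute)
  qed
  have "Cn_on n U (\<lambda>y. \<Sum>b\<in>Basis. F' (L y) b * l b y v)" for v
  proof (intro Cn_on_sum Cn_on_mult)
    fix b :: 'b assume "b \<in> Basis"
    show "Cn_on n U (\<lambda>y. F' (L y) b)"
      by (rule Suc.IH) (use F'(2) Suc.prems(2) Suc.prems(3)[THEN Cn_on_Suc_imp] in auto)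
    show "Cn_on n U (\<lambda>y. l b y v)" using l(2) \<open>b \<in> Basis\<close> by auto
  qed
  with der show ?case
    unfolding Cn_on.simps by (intro exI[of _ "\<lambda>y v. \<Sum>b\<in>Basis. F' (L y) b * l b y v"]) blast
qed

text \<open>Used with exponent 1/2 for the height of a point of the hemisphere and with -1/2 for its
  reciprocal. The exponent is generalised because each derivative lowers it by one.\<close>

lemma Cn_on_powr: "Cn_on n {0<..} (\<lambda>t::real. t powr s)"
proof (induction n arbitrary: s)
  case 0
  have "continuous_on {0<..} (\<lambda>t::real. t powr s)"
    by (rule continuous_on_powr) (auto intro: continuous_on_id continuous_on_const)
  then show ?case by simp
next
  case (Suc n)
  have "\<forall>t\<in>{0<..}. ((\<lambda>t. t powr s) has_derivative (\<lambda>v. (s * v) * t powr (s - 1))) (at t)"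
    by (auto intro!: derivative_eq_intros simp: powr_diff field_simps)
  moreover have "\<forall>v. Cn_on n {0<..} (\<lambda>t::real. (s * v) * t powr (s - 1))"
    by (auto intro: Cn_on_mult Cn_on_const Suc.IH)
  ultimately show ?case by (auto intro!: exI[of _ "\<lambda>t v. (s * v) * t powr (s - 1)"])
qed

text \<open>On the overlap the two derivatives agree by uniqueness, so they glue to one derivative
  on the union. This is how a function on a disc is extended by zero to the plane.\<close>

lemma Cn_on_Un:
  assumes "open U" "open V" "Cn_on n U F" "Cn_on n V F"
  shows "Cn_on n (U \<union> V) F"
  using assms(3,4)
proof (induction n arbitrary: F)
  case 0 then show ?case using assms(1,2) by (simp add: continuous_on_open_Un)
next
  case (Suc n)
  obtain P Q where PQ: "\<forall>y\<in>U. (F has_derivative P y) (at y)" "\<forall>v. Cn_on n U (\<lambda>y. P y v)"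
     "\<forall>y\<in>V. (F has_derivative Q y) (at y)" "\<forall>v. Cn_on n V (\<lambda>y. Q y v)"
    using Suc.prems by auto
  define R where "R y = (if y \<in> U then P y else Q y)" for y
  have RU: "y \<in> U \<Longrightarrow> R y = P y" for y by (simp add: R_def)
  have RV: "y \<in> V \<Longrightarrow> R y = Q y" for y
    using PQ(1,3) by (metis R_def has_derivative_unique)
  have "Cn_on n (U \<union> V) (\<lambda>y. R y v)" for v
  proof (rule Suc.IH)
    show "Cn_on n U (\<lambda>y. R y v)" using Cn_on_cong[OF assms(1) PQ(2)[rule_format, of v]] RU by auto
    show "Cn_on n V (\<lambda>y. R y v)" using Cn_on_cong[OF assms(2) PQ(4)[rule_format, of v]] RV by auto
  qed
  moreover have "\<forall>y\<in>U\<union>V. (F has_derivative R y) (at y)"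
    using PQ RU RV by auto
  ultimately show ?case by auto
qed

section \<open>Change of variables in the plane\<close>

text \<open>The theorem on change of variables lives on \<open>real^'m\<close>, Fubini on products;
  these maps translate between the two models of the plane.\<close>

definition vec2 :: "real \<times> real \<Rightarrow> real^2" where "vec2 z = vector [fst z, snd z]"
definition pair2 :: "real^2 \<Rightarrow> real \<times> real" where "pair2 p = (p$1, p$2)"

lemma vec2_nth [simp]: "vec2 z $ 1 = fst z" "vec2 z $ 2 = snd z"
  by (simp_all add: vec2_def)

lemma vec2_pair2 [simp]: "vec2 (pair2 p) = p"
  by (simp add: vec_eq_iff forall_2 pair2_def)

lemma pair2_vec2 [simp]: "pair2 (vec2 z) = z"
  by (simp add: pair2_def)

lemma bounded_linear_vec2: "bounded_linear vec2"
  unfolding linear_conv_bounded_linear[symmetric]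
  by (rule linearI) (auto simp: vec_eq_iff forall_2)

lemma bounded_linear_pair2: "bounded_linear pair2"
  unfolding linear_conv_bounded_linear[symmetric]
  by (rule linearI) (auto simp: pair2_def)

lemma borel_measurable_vec2 [measurable]: "vec2 \<in> borel_measurable borel"
  using bounded_linear_vec2
  by (intro borel_measurable_continuous_onI linear_continuous_on)

lemma borel_measurable_pair2 [measurable]: "pair2 \<in> borel_measurable borel"
  using bounded_linear_pair2
  by (intro borel_measurable_continuous_onI linear_continuous_on)

text \<open>Lebesgue measure is determined by its values on boxes, and \<open>vec2\<close> pulls a
  box back to the box with the same sides.\<close>

lemma lborel_distr_vec2: "distr lborel borel vec2 = lborel"
proof (rule lborel_eqI[symmetric])
  fix l u :: "real^2" assume le: "\<And>b. b \<in> Basis \<Longrightarrow> l \<bullet> b \<le> u \<bullet> b"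
  have le': "l $ i \<le> u $ i" for i
    using le[of "axis i 1"] by (simp add: axis_in_Basis_iff inner_axis)
  have "vec2 -` box l u = box (pair2 l) (pair2 u)"
    by (auto simp: box_def pair2_def Basis_vec_def inner_axis forall_2 Basis_prod_def)
  then have "emeasure (distr lborel borel vec2) (box l u) = emeasure lborel (box (pair2 l) (pair2 u))"
    by (simp add: emeasure_distr)
  also have "\<dots> = ennreal (\<Prod>b\<in>Basis. (pair2 u - pair2 l) \<bullet> b)"
    using le' by (intro emeasure_lborel_box) (auto simp: pair2_def Basis_prod_def)
  also have "(\<Prod>b\<in>Basis. (pair2 u - pair2 l) \<bullet> b) = (u$1 - l$1) * (u$2 - l$2)"
  proof -
    have B: "Basis = {(1::real,0::real), (0,1)}" by (auto simp: Basis_prod_def)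
    show ?thesis unfolding B by (simp add: pair2_def)
  qed
  also have "\<dots> = (\<Prod>b\<in>Basis. (u - l) \<bullet> b)"
  proof -
    have B: "Basis = {axis 1 1 :: real^2, axis 2 1}"
      by (auto simp: Basis_vec_def) (metis exhaust_2)
    have "axis 1 1 \<noteq> (axis 2 1 :: real^2)" by (simp add: axis_eq_axis)
    then show ?thesis unfolding B by (simp add: inner_axis)
  qed
  finally show "emeasure (distr lborel borel vec2) (box l u) = (\<Prod>b\<in>Basis. (u - l) \<bullet> b)" .
qed simp

lemma integrable_vec2:
  fixes f :: "real^2 \<Rightarrow> real"
  assumes [measurable]: "f \<in> borel_measurable borel"
  shows "integrable lborel (\<lambda>z. f (vec2 z)) \<longleftrightarrow> integrable lborel f"
  using integrable_distr_eq[of vec2 lborel borel f] by (simp add: lborel_distr_vec2)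

lemma integral_vec2:
  fixes f :: "real^2 \<Rightarrow> real"
  assumes [measurable]: "f \<in> borel_measurable borel"
  shows "(\<integral>z. f (vec2 z) \<partial>lborel) = integral\<^sup>L lborel f"
  using integral_distr[of vec2 lborel borel f] by (simp add: lborel_distr_vec2)

text \<open>Reduces to the vector-valued theorem by viewing scalars as elements of
  \<open>real^1\<close>.\<close>

lemma has_absolute_integral_change_of_variables_scalar:
  fixes f :: "real^'m::{finite,wellorder} \<Rightarrow> real" and g :: "real^'m::_ \<Rightarrow> real^'m::_"
  assumes "S \<in> sets lebesgue"
    and "\<And>x. x \<in> S \<Longrightarrow> (g has_derivative g' x) (at x within S)"
    and "inj_on g S"
  shows "(\<lambda>x. \<bar>det (matrix (g' x))\<bar> * f(g x)) absolutely_integrable_on S \<and>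
           integral S (\<lambda>x. \<bar>det (matrix (g' x))\<bar> * f(g x)) = b
     \<longleftrightarrow> f absolutely_integrable_on (g ` S) \<and> integral (g ` S) f = b"
proof -
  have "(\<lambda>x. \<bar>det (matrix (g' x))\<bar> *\<^sub>R (vec (f(g x)) :: real^1)) absolutely_integrable_on S \<and>
           integral S (\<lambda>x. \<bar>det (matrix (g' x))\<bar> *\<^sub>R (vec (f(g x)) :: real^1)) = vec b
     \<longleftrightarrow> (\<lambda>x. vec (f x) :: real^1) absolutely_integrable_on (g ` S) \<and> integral (g ` S) (\<lambda>x. vec (f x)) = (vec b :: real^1)"
    by (intro has_absolute_integral_change_of_variables assms)
  then show ?thesis
    by (simp add: absolutely_integrable_on_1_iff integral_on_1_eq)
qed

text \<open>Taking \<open>b = p\<close> and \<open>b = q\<close> splits an equivalence of the form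
  "integrable with value b" into equivalence of integrability and equality of values.\<close>

lemma integral_eq_of_iff:
  assumes "\<And>b. (P \<and> p = b) \<longleftrightarrow> (Q \<and> q = b)"
  shows "P \<longleftrightarrow> Q" "P \<Longrightarrow> p = q"
  using assms by blast+

text \<open>Serves both polar coordinates and the sphere. Borel measurability of the two restricted
  integrands allows the completed Lebesgue measure to be replaced by \<open>lborel\<close>, where
  Fubini is available.\<close>

lemma change_of_variables_plane:
  fixes g :: "real \<times> real \<Rightarrow> real \<times> real" and f :: "real \<times> real \<Rightarrow> real"
  assumes S[measurable]: "S \<in> sets borel" and gS[measurable]: "g ` S \<in> sets borel"
    and der: "\<And>z. z \<in> S \<Longrightarrow>
      (g has_derivative (\<lambda>h. (A z * fst h + B z * snd h, C z * fst h + D z * snd h))) (at z)"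
    and inj: "inj_on g S"
    and m1[measurable]: "(\<lambda>z. indicator S z * (\<bar>A z * D z - B z * C z\<bar> * f (g z))) \<in> borel_measurable borel"
    and m2[measurable]: "(\<lambda>y. indicator (g ` S) y * f y) \<in> borel_measurable borel"
  shows "integrable lborel (\<lambda>z. indicator S z * (\<bar>A z * D z - B z * C z\<bar> * f (g z))) \<longleftrightarrow>
         integrable lborel (\<lambda>y. indicator (g ` S) y * f y)" (is "integrable _ ?l \<longleftrightarrow> integrable _ ?r")
    and "(\<integral>z. indicator S z * (\<bar>A z * D z - B z * C z\<bar> * f (g z)) \<partial>lborel) =
         (\<integral>y. indicator (g ` S) y * f y \<partial>lborel)"
proof -
  define G where "G p = vec2 (g (pair2 p))" for p
  define G' where "G' p h = (let z = pair2 p; k = pair2 h in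
     vec2 (A z * fst k + B z * snd k, C z * fst k + D z * snd k))" for p h
  define T where "T = vec2 ` S"
  have img: "p \<in> vec2 ` X \<longleftrightarrow> pair2 p \<in> X" for p X
    by (metis image_iff pair2_vec2 vec2_pair2)
  have TS: "p \<in> T \<longleftrightarrow> pair2 p \<in> S" for p
    unfolding T_def by (rule img)
  have GT: "p \<in> G ` T \<longleftrightarrow> pair2 p \<in> g ` S" for p
    using img[of p "g ` S"] by (simp add: T_def G_def image_image)
  have T_eq: "T = pair2 -` S \<inter> space borel" by (auto simp: TS)
  have T [measurable]: "T \<in> sets borel" unfolding T_eq by (rule measurable_sets[OF borel_measurable_pair2 S])
  have GT_eq: "G ` T = pair2 -` (g ` S) \<inter> space borel" by (rule set_eqI) (simp only: GT space_borel vimage_eq Int_UNIV_right)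
  have GTm [measurable]: "G ` T \<in> sets borel" unfolding GT_eq by (rule measurable_sets[OF borel_measurable_pair2 gS])
  have derG: "(G has_derivative G' p) (at p within T)" if "p \<in> T" for p
  proof -
    have "(pair2 has_derivative pair2) (at p within T)"
      using bounded_linear_pair2 bounded_linear_imp_has_derivative by blast
    moreover have "(g has_derivative (\<lambda>h. (A (pair2 p) * fst h + B (pair2 p) * snd h, C (pair2 p) * fst h + D (pair2 p) * snd h))) (at (pair2 p))"
      using der that TS by blast
    ultimately have "((\<lambda>p. g (pair2 p)) has_derivative (\<lambda>h. (A (pair2 p) * fst (pair2 h) + B (pair2 p) * snd (pair2 h), C (pair2 p) * fst (pair2 h) + D (pair2 p) * snd (pair2 h)))) (at p within T)"
      by (rule has_derivative_compose)
    from bounded_linear.has_derivative[OF bounded_linear_vec2 this]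
    show ?thesis unfolding G_def G'_def Let_def .
  qed
  have det: "det (matrix (G' p)) = A (pair2 p) * D (pair2 p) - B (pair2 p) * C (pair2 p)" for p
    by (simp add: det_2 matrix_def G'_def Let_def pair2_def axis_def)
  have injG: "inj_on G T"
    using inj unfolding inj_on_def G_def T_def by (metis imageE pair2_vec2)
  define J where "J z = \<bar>A z * D z - B z * C z\<bar>" for z
  define L where "L p = indicator S (pair2 p) * (J (pair2 p) * f (g (pair2 p)))" for p
  define R where "R p = indicator (g ` S) (pair2 p) * f (pair2 p)" for p
  have [measurable]: "L \<in> borel_measurable borel"
    unfolding L_def J_def by (rule measurable_compose[OF borel_measurable_pair2 m1])
  have [measurable]: "R \<in> borel_measurable borel"
    unfolding R_def by (rule measurable_compose[OF borel_measurable_pair2 m2])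
  have iff: "((\<lambda>p. J (pair2 p) * f (pair2 (G p))) absolutely_integrable_on T \<and>
           integral T (\<lambda>p. J (pair2 p) * f (pair2 (G p))) = b)
     \<longleftrightarrow> ((\<lambda>p. f (pair2 p)) absolutely_integrable_on (G ` T) \<and> integral (G ` T) (\<lambda>p. f (pair2 p)) = b)" for b
    using has_absolute_integral_change_of_variables_scalar[OF _ derG injG, of "\<lambda>p. f (pair2 p)" b]
    by (simp add: det J_def)
  have Leq: "L = (\<lambda>p. indicator T p *\<^sub>R (J (pair2 p) * f (pair2 (G p))))"
    by (rule ext) (auto simp: L_def G_def indicator_def TS)
  have Req: "R = (\<lambda>p. indicator (G ` T) p *\<^sub>R f (pair2 p))"
    by (rule ext) (auto simp: R_def GT indicator_def)
  have absL: "(\<lambda>p. J (pair2 p) * f (pair2 (G p))) absolutely_integrable_on T \<longleftrightarrow> integrable lborel L"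
    unfolding set_integrable_def Leq[symmetric] by (rule integrable_completion) simp
  have absR: "(\<lambda>p. f (pair2 p)) absolutely_integrable_on (G ` T) \<longleftrightarrow> integrable lborel R"
    unfolding set_integrable_def Req[symmetric] by (rule integrable_completion) simp
  have intL: "integral T (\<lambda>p. J (pair2 p) * f (pair2 (G p))) = integral\<^sup>L lborel L" if "integrable lborel L"
    using set_lebesgue_integral_eq_integral(2)[OF absL[THEN iffD2, OF that]]
    unfolding set_lebesgue_integral_def Leq[symmetric] by (simp add: integral_completion)
  have intR: "integral (G ` T) (\<lambda>p. f (pair2 p)) = integral\<^sup>L lborel R" if "integrable lborel R"
    using set_lebesgue_integral_eq_integral(2)[OF absR[THEN iffD2, OF that]]
    unfolding set_lebesgue_integral_def Req[symmetric] by (simp add: integral_completion)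
  have 1: "integrable lborel L \<longleftrightarrow> integrable lborel R"
    using integral_eq_of_iff(1)[OF iff] absL absR by simp
  have 2: "integral\<^sup>L lborel L = integral\<^sup>L lborel R"
  proof (cases "integrable lborel L")
    case True then show ?thesis
      using integral_eq_of_iff(2)[OF iff] absL 1 intL intR by metis
  next
    \<comment> \<open>If one side is not integrable then neither is the other, and both Bochner
      integrals take the default value 0.\<close>
    case False then show ?thesis using 1 by (simp add: not_integrable_integral_eq)
  qed
  have Lv: "L (vec2 z) = ?l z" "R (vec2 z) = ?r z" for z by (simp_all add: L_def R_def J_def)
  show "integrable lborel ?l \<longleftrightarrow> integrable lborel ?r"
    using 1 integrable_vec2[of L] integrable_vec2[of R] by (simp add: Lv)
  show "integral\<^sup>L lborel ?l = integral\<^sup>L lborel ?r"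
    using 2 integral_vec2[of L] integral_vec2[of R] by (simp add: Lv)
qed

section \<open>Polar coordinates and integrability of the logarithm\<close>

text \<open>Near 0, \<open>- ln (sqrt r) \<le> 1 / sqrt r\<close> gives the bound
  \<open>2 * sqrt r\<close>. Continuity up to 0 lets the fundamental theorem of calculus be applied
  to antiderivatives containing \<open>r * ln r\<close> on intervals starting at 0.\<close>

lemma continuous_on_times_ln: "continuous_on {0..} (\<lambda>r::real. r * ln r)"
proof -
  have "continuous (at r within {0..}) (\<lambda>r::real. r * ln r)" if "r \<in> {0..}" for r
  proof (cases "r = 0")
    case True
    have bound: "norm (r * ln r) \<le> 2 * sqrt r" if "0 \<le> r" "r < 1" for r :: real
    proof (cases "r = 0")
      case False
      then have s: "0 < sqrt r" using that by simp
      have "- ln (sqrt r) = ln (1 / sqrt r)" using s by (simp add: ln_div)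
      also have "\<dots> \<le> 1 / sqrt r" using s by (intro ln_bound) simp
      finally have "r * (- ln r) \<le> r * (2 / sqrt r)"
        using that False by (intro mult_left_mono) (simp_all add: ln_sqrt field_simps)
      also have "\<dots> = 2 * sqrt r" using that real_div_sqrt[of r] by (metis mult.commute times_divide_eq_right)
      finally show ?thesis using that False by (simp add: abs_mult)
    qed simp
    have "((\<lambda>r::real. 2 * sqrt r) \<longlongrightarrow> 2 * sqrt 0) (at 0 within {0..})"
      by (intro tendsto_intros)
    then have "((\<lambda>r::real. 2 * sqrt r) \<longlongrightarrow> 0) (at 0 within {0..})" by simp
    moreover have "\<forall>\<^sub>F r::real in at 0 within {0..}. norm (r * ln r) \<le> 2 * sqrt r"
      unfolding eventually_at using bound by (intro exI[of _ 1]) (auto simp: dist_real_def)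
    ultimately have "((\<lambda>r::real. r * ln r) \<longlongrightarrow> 0) (at 0 within {0..})"
      by (rule Lim_null_comparison[rotated])
    then show ?thesis using True by (simp add: continuous_within)
  next
    case False
    then have "isCont (\<lambda>r. r * ln r) r"
      by (intro isCont_mult continuous_ident isCont_ln)
    then show ?thesis by (rule continuous_at_imp_continuous_at_within)
  qed
  then show ?thesis by (simp add: continuous_on_eq_continuous_within)
qed

section \<open>Injectivity of the angle; local integrability of the logarithm on the line\<close>

lemma sin_cos_inj_on_2pi:
  assumes "0 \<le> s" "s < 2*pi" "0 \<le> t" "t < 2*pi" "cos s = cos t" "sin s = sin t"
  shows "s = t"
proof -
  obtain n :: int where n: "s = t + 2 * pi * n" using sin_cos_eq_iff[of s t] assms by auto
  have "2 * pi * n < 2 * pi * 1" "2 * pi * (-1) < 2 * pi * n" using n assms by linarith+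
  then have "real_of_int n < 1" "-1 < real_of_int n" by (auto intro: mult_left_less_imp_less[of "2 * pi"])
  then have "n = 0" by linarith
  with n show ?thesis by simp
qed

text \<open>The antiderivative is \<open>y * ln y - y\<close>. Since the logarithm has constant sign
  on the unit interval, the gauge integral so obtained is already absolute.\<close>

lemma integrable_ln_unit: "integrable lborel (\<lambda>y::real. indicator {0..1} y * ln y)"
proof -
  have "((\<lambda>y::real. ln y) has_integral ((1 * ln 1 - 1) - (0 * ln 0 - 0))) {0..1}"
  proof (rule fundamental_theorem_of_calculus_interior)
    show "continuous_on {0..1} (\<lambda>y::real. y * ln y - y)"
      by (intro continuous_intros continuous_on_subset[OF continuous_on_times_ln]) auto
  next
    fix y :: real assume "y \<in> {0<..<1}"
    then show "((\<lambda>y. y * ln y - y) has_vector_derivative ln y) (at y)"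
      by (auto intro!: derivative_eq_intros simp: has_real_derivative_iff_has_vector_derivative[symmetric])
  qed simp
  then have "(\<lambda>y::real. - ln y) integrable_on {0..1}"
    by (auto intro: integrable_neg)
  then have "(\<lambda>y::real. - ln y) absolutely_integrable_on {0..1}"
    by (rule nonnegative_absolutely_integrable_1) (use ln_le_zero_iff in \<open>fastforce simp: le_less\<close>)
  then have "integrable lborel (\<lambda>y::real. indicator {0..1} y *\<^sub>R (- ln y))"
    unfolding set_integrable_def by (subst (asm) integrable_completion) auto
  then show ?thesis by simp
qed

text \<open>Within distance 1 of \<open>t\<close> the integrand is a translate, or a reflected
  translate, of the logarithm on the unit interval; farther away \<open>ln s \<le> s\<close> is
  bounded on \<open>{a..b}\<close>.\<close>

lemma integrable_indicator_ln_abs: "integrable lborel (\<lambda>x::real. indicator {a..b} x * ln \<bar>x - t\<bar>)"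
proof -
  let ?h = "\<lambda>y::real. indicator {0..1} y * ln y"
  have pos: "integrable lborel (\<lambda>x. ?h (- t + 1 * x))"
    by (rule lborel_integrable_real_affine[OF integrable_ln_unit]) simp
  have neg: "integrable lborel (\<lambda>x. ?h (t + (-1) * x))"
    by (rule lborel_integrable_real_affine[OF integrable_ln_unit]) simp
  have box: "integrable lborel (\<lambda>x. indicator {a..b} x * (\<bar>a\<bar> + \<bar>b\<bar> + \<bar>t\<bar>))"
    by (intro integrable_mult_left integrable_real_indicator) (auto simp: emeasure_lborel_Icc_eq)
  show ?thesis
  proof (rule Bochner_Integration.integrable_bound)
    show "integrable lborel (\<lambda>x. \<bar>?h (- t + 1 * x)\<bar> + \<bar>?h (t + (-1) * x)\<bar> + indicator {a..b} x * (\<bar>a\<bar> + \<bar>b\<bar> + \<bar>t\<bar>))"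
      using pos neg box by (intro Bochner_Integration.integrable_add integrable_abs)
    show "AE x in lborel. norm (indicator {a..b} x * ln \<bar>x - t\<bar>) \<le>
        norm (\<bar>?h (- t + 1 * x)\<bar> + \<bar>?h (t + (-1) * x)\<bar> + indicator {a..b} x * (\<bar>a\<bar> + \<bar>b\<bar> + \<bar>t\<bar>))"
    proof (rule AE_I2)
      fix x
      have nn: "0 \<le> indicator {a..b} x * (\<bar>a\<bar> + \<bar>b\<bar> + \<bar>t\<bar>)" by simp
      show "norm (indicator {a..b} x * ln \<bar>x - t\<bar>) \<le>
        norm (\<bar>?h (- t + 1 * x)\<bar> + \<bar>?h (t + (-1) * x)\<bar> + indicator {a..b} x * (\<bar>a\<bar> + \<bar>b\<bar> + \<bar>t\<bar>))"
      proof (cases "x \<in> {a..b}")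
        case x: True
        consider "\<bar>x - t\<bar> \<ge> 1" | "0 \<le> x - t" "x - t \<le> 1" | "x - t \<le> 0" "- 1 \<le> x - t"
          by linarith
        then show ?thesis
        proof cases
          case 1
          then have "\<bar>ln \<bar>x - t\<bar>\<bar> \<le> \<bar>x - t\<bar>" using ln_bound[of "\<bar>x - t\<bar>"] by simp
          also have "\<dots> \<le> \<bar>a\<bar> + \<bar>b\<bar> + \<bar>t\<bar>" using x by auto
          finally have le: "norm (indicator {a..b} x * ln \<bar>x - t\<bar>) \<le> indicator {a..b} x * (\<bar>a\<bar> + \<bar>b\<bar> + \<bar>t\<bar>)"
            using x by simp
          show ?thesis by (rule order_trans[OF le]) auto
        next
          case 2 then show ?thesis using x by (simp add: abs_mult)
        next
          case 3 
          then have "\<bar>x - t\<bar> = t - x" by simp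
          then show ?thesis using x 3 by (simp add: abs_mult)
        qed
      qed (simp add: nn)
    qed
    show "(\<lambda>x. indicator {a..b} x * ln \<bar>x - t\<bar>) \<in> borel_measurable lborel"
      by (intro borel_measurable_times borel_measurable_indicator borel_measurable_ln borel_measurable_abs) auto
  qed
qed

lemma borel_measurable_fst_plane: "fst \<in> borel_measurable (borel :: (real \<times> real) measure)"
  by (intro borel_measurable_continuous_onI continuous_intros)

text \<open>The singularity depends on one coordinate only, so the product of \<open>l\<close> with
  a bound for \<open>k\<close> dominates. It is applied to \<open>ln r\<close> in polar coordinates
  and to \<open>ln \<bar>\<tau> - t\<bar>\<close> in coordinates of height and longitude.\<close>

lemma integrable_times_fst:
  fixes k :: "real \<times> real \<Rightarrow> real"
  assumes k: "continuous_on ({a..b} \<times> {c..d}) k"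
    and l: "integrable lborel (\<lambda>x. indicator {a..b} x * l x)"
  shows "integrable lborel (\<lambda>z. indicator ({a..b} \<times> {c..d}) z * (k z * l (fst z)))"
proof -
  have "compact (k ` ({a..b} \<times> {c..d}))"
    by (intro compact_continuous_image k compact_Times compact_Icc)
  from compact_imp_bounded[OF this] obtain M where "\<forall>y \<in> k ` ({a..b} \<times> {c..d}). norm y \<le> M"
    unfolding bounded_iff by (elim exE)
  then have M: "\<bar>k z\<bar> \<le> M" if "z \<in> {a..b} \<times> {c..d}" for z
    using imageI[OF that, of k] by (simp only: real_norm_def)
  let ?l = "\<lambda>x. indicator {a..b} x * l x"
  have lm [measurable]: "?l \<in> borel_measurable borel"
    using l by (auto dest: borel_measurable_integrable)
  have km [measurable]: "(\<lambda>z. indicator ({a..b} \<times> {c..d}) z *\<^sub>R k z) \<in> borel_measurable borel"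
    by (intro borel_measurable_continuous_on_indicator k) (auto intro: borel_closed closed_Times)
  have eq: "indicator ({a..b} \<times> {c..d}) z * (k z * l (fst z)) =
      (indicator ({a..b} \<times> {c..d}) z *\<^sub>R k z) * ?l (fst z)" for z
    by (auto simp: indicator_def)
  have "integrable (lborel \<Otimes>\<^sub>M lborel) (\<lambda>z. ?l (fst z) * (indicator {c..d} (snd z) * M))"
  proof (rule lborel_pair.Fubini_integrable)
    have "integrable lborel (\<lambda>x. \<bar>?l x\<bar> * (\<integral>y. norm (indicator {c..d} y * M) \<partial>lborel))"
      using l by (intro integrable_mult_left integrable_abs)
    then show "integrable lborel (\<lambda>x. \<integral>y. norm (?l (fst (x, y)) * (indicator {c..d} (snd (x, y)) * M)) \<partial>lborel)"
      by (simp add: abs_mult)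
    show "AE x in lborel. integrable lborel (\<lambda>y. ?l (fst (x, y)) * (indicator {c..d} (snd (x, y)) * M))"
      by (intro AE_I2 integrable_mult_right integrable_mult_left integrable_real_indicator)
         (auto simp: emeasure_lborel_Icc_eq)
    have "(\<lambda>z::real \<times> real. ?l (fst z)) \<in> borel_measurable borel"
      by (rule measurable_compose[OF borel_measurable_fst_plane lm])
    moreover have "(\<lambda>z::real \<times> real. indicator {c..d} (snd z) * M :: real) \<in> borel_measurable borel"
      by (rule measurable_compose[of snd borel borel "\<lambda>y. indicator {c..d} y * M"])
         (auto intro!: borel_measurable_continuous_onI continuous_intros)
    ultimately have "(\<lambda>z. ?l (fst z) * (indicator {c..d} (snd z) * M)) \<in> borel_measurable (borel :: (real \<times> real) measure)"
      by (rule borel_measurable_times)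
    then show "(\<lambda>z. ?l (fst z) * (indicator {c..d} (snd z) * M)) \<in> borel_measurable (lborel \<Otimes>\<^sub>M lborel)"
      unfolding lborel_prod by simp
  qed
  then have I: "integrable lborel (\<lambda>z. ?l (fst z) * (indicator {c..d} (snd z) * M))"
    by (simp add: lborel_prod)
  show ?thesis
  proof (rule Bochner_Integration.integrable_bound[OF I])
    show "(\<lambda>z. indicator ({a..b} \<times> {c..d}) z * (k z * l (fst z))) \<in> borel_measurable lborel"
      unfolding eq using measurable_compose[OF borel_measurable_fst_plane lm] km
      by (auto intro: borel_measurable_times)
    show "AE z in lborel. norm (indicator ({a..b} \<times> {c..d}) z * (k z * l (fst z))) \<le> norm (?l (fst z) * (indicator {c..d} (snd z) * M))"
    proof (rule AE_I2)
      fix z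
      show "norm (indicator ({a..b} \<times> {c..d}) z * (k z * l (fst z))) \<le> norm (?l (fst z) * (indicator {c..d} (snd z) * M))"
      proof (cases "z \<in> {a..b} \<times> {c..d}")
        case True
        then have "\<bar>k z\<bar> * \<bar>l (fst z)\<bar> \<le> \<bar>M\<bar> * \<bar>l (fst z)\<bar>"
          using M[OF True] by (intro mult_right_mono) auto
        then show ?thesis using True by (auto simp: abs_mult mem_Times_iff mult.commute)
      qed simp
    qed
  qed
qed

section \<open>Null lines, polar coordinates, and the logarithm in the plane\<close>

lemma AE_lborel_inner_neq:
  fixes b :: "'a::euclidean_space"
  assumes "b \<in> Basis" shows "AE z in lborel. z \<bullet> b \<noteq> c"
proof -
  have "{z. z \<bullet> b = c} \<in> null_sets lebesgue"
    using negligible_standard_hyperplane[OF assms, of c] by (simp add: negligible_iff_null_sets)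
  moreover have "{z. z \<bullet> b = c} \<in> sets borel"
    by (intro borel_closed closed_Collect_eq continuous_intros)
  ultimately have "{z. z \<bullet> b = c} \<in> null_sets lborel"
    by (auto simp: null_sets_def)
  then show ?thesis by (rule AE_I') auto
qed

lemma AE_snd_neq: "AE z in lborel. snd (z :: real \<times> real) \<noteq> c"
  using AE_lborel_inner_neq[of "(0, 1) :: real \<times> real" c] by (simp add: Basis_prod_def inner_prod_def)

lemma polar_coordinates:
  fixes f :: "real \<times> real \<Rightarrow> real"
  assumes f [measurable]: "f \<in> borel_measurable borel"
  shows "integrable lborel f \<longleftrightarrow>
      integrable lborel (\<lambda>z. indicator ({0..} \<times> {0..2*pi}) z * (fst z * f (fst z * cos (snd z), fst z * sin (snd z))))"
      (is "_ \<longleftrightarrow> integrable _ ?P")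
    and "integral\<^sup>L lborel f =
      (\<integral>z. indicator ({0..} \<times> {0..2*pi}) z * (fst z * f (fst z * cos (snd z), fst z * sin (snd z))) \<partial>lborel)"
proof -
  define g where "g z = (fst z * cos (snd z), fst z * sin (snd z))" for z :: "real \<times> real"
  \<comment> \<open>Half-open in the angle and without radius 0, so that \<open>g\<close> is
    injective with image the punctured plane. Against the closed strip of the statement only the ray
    at angle \<open>2*pi\<close> has to be discarded as a null set; at radius 0 the factor
    \<open>fst z\<close> already vanishes.\<close>
  define S :: "(real \<times> real) set" where "S = {0<..} \<times> {0..<2*pi}"
  have S [measurable]: "S \<in> sets borel"
    unfolding S_def by (simp add: borel_prod[symmetric])
  have gm [measurable]: "g \<in> borel_measurable borel"
    unfolding g_def by (intro borel_measurable_continuous_onI continuous_intros)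
  have ng: "norm (g z) = \<bar>fst z\<bar>" for z
  proof -
    have "(fst z * cos (snd z))\<^sup>2 + (fst z * sin (snd z))\<^sup>2 = (fst z)\<^sup>2 * ((cos (snd z))\<^sup>2 + (sin (snd z))\<^sup>2)"
      by algebra
    then show ?thesis by (simp add: g_def norm_Pair)
  qed
  have img: "g ` S = - {0}"
  proof (intro equalityI subsetI)
    fix y assume "y \<in> g ` S"
    then obtain z where "y = g z" "fst z > 0" by (auto simp: S_def)
    then have "norm y > 0" using ng by simp
    then show "y \<in> - {0}" by auto
  next
    fix y :: "real \<times> real" assume "y \<in> - {0}"
    then have n: "norm y > 0" by simp
    obtain a b where y: "y = (a, b)" by force
    have "(a / norm y)\<^sup>2 + (b / norm y)\<^sup>2 = (a\<^sup>2 + b\<^sup>2) / (norm y)\<^sup>2"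
      by (simp add: power_divide add_divide_distrib)
    also have "\<dots> = 1" using n y by (auto simp: norm_Pair sum_power2_gt_zero_iff)
    finally obtain t where t: "0 \<le> t" "t < 2*pi" "a / norm y = cos t" "b / norm y = sin t"
      using sincos_total_2pi by metis
    then have "y = g (norm y, t)" using n unfolding g_def y by (simp add: field_simps)
    then show "y \<in> g ` S" using n t by (auto simp: S_def)
  qed
  have inj: "inj_on g S"
  proof (rule inj_onI)
    fix z w assume zw: "z \<in> S" "w \<in> S" "g z = g w"
    then have r: "fst z = fst w" using ng[of z] ng[of w] by (auto simp: S_def)
    moreover have "fst w \<noteq> 0" using zw(2) by (auto simp: S_def)
    ultimately have "cos (snd z) = cos (snd w)" "sin (snd z) = sin (snd w)" using zw(3) by (simp_all add: g_def)
    moreover have "0 \<le> snd z" "snd z < 2*pi" "0 \<le> snd w" "snd w < 2*pi"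
      using zw(1,2) by (simp_all add: S_def mem_Times_iff)
    ultimately have "snd z = snd w" by (blast intro: sin_cos_inj_on_2pi)
    with r show "z = w" by (simp add: prod_eq_iff)
  qed
  have der: "(g has_derivative (\<lambda>h. (cos (snd z) * fst h + (- fst z * sin (snd z)) * snd h,
      sin (snd z) * fst h + (fst z * cos (snd z)) * snd h))) (at z)" for z
    unfolding g_def by (auto intro!: derivative_eq_intros simp: algebra_simps)
  have det: "\<bar>cos (snd z) * (fst z * cos (snd z)) - (- fst z * sin (snd z)) * sin (snd z)\<bar> = \<bar>fst z\<bar>" for z :: "real \<times> real"
  proof -
    have "cos (snd z) * (fst z * cos (snd z)) - (- fst z * sin (snd z)) * sin (snd z) = fst z * ((cos (snd z))\<^sup>2 + (sin (snd z))\<^sup>2)"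
      by algebra
    then show ?thesis by simp
  qed
  have m: "(\<lambda>z. indicator S z * (\<bar>fst z\<bar> * f (g z))) \<in> borel_measurable borel"
    by (intro borel_measurable_times borel_measurable_indicator S borel_measurable_abs
        borel_measurable_fst_plane measurable_compose[OF gm f])
  have m': "(\<lambda>y. indicator (g ` S) y * f y) \<in> borel_measurable borel"
    unfolding img by measurable
  have gS: "g ` S \<in> sets borel" unfolding img by simp
  note cv = change_of_variables_plane[OF S gS der inj, unfolded det, OF m m']
  have ae: "AE z in lborel. indicator S z * (\<bar>fst z\<bar> * f (g z)) = ?P z"
    using AE_snd_neq[of "2*pi"] by eventually_elim (auto simp: S_def g_def indicator_def)
  have ae': "AE y in lborel. indicator (g ` S) y * f y = f y"
    using AE_lborel_singleton[of "0 :: real \<times> real"] by eventually_elim (auto simp: img)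
  have Pm: "?P \<in> borel_measurable borel"
  proof -
    have "{0..} \<times> {0..2*pi} \<in> sets (borel :: (real \<times> real) measure)"
      by (intro borel_closed closed_Times) auto
    moreover have "(\<lambda>z. f (g z)) \<in> borel_measurable borel" by measurable
    ultimately have "(\<lambda>z. indicator ({0..} \<times> {0..2*pi}) z * (fst z * f (g z))) \<in> borel_measurable borel"
      by (intro borel_measurable_times borel_measurable_indicator borel_measurable_fst_plane)
    then show ?thesis by (simp add: g_def)
  qed
  show "integrable lborel f \<longleftrightarrow> integrable lborel ?P"
    using cv(1) integrable_cong_AE[OF _ _ ae] integrable_cong_AE[OF _ _ ae'] m m' Pm by simp
  show "integral\<^sup>L lborel f = integral\<^sup>L lborel ?P"
    using cv(2) integral_cong_AE[OF _ _ ae] integral_cong_AE[OF _ _ ae'] m m' Pm by simp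
qed

lemma abs_times_ln_le: "0 \<le> r \<Longrightarrow> \<bar>r * ln r\<bar> \<le> 1 + r\<^sup>2" for r :: real
proof -
  assume r: "0 \<le> r"
  consider "r = 0" | "0 < r" "r \<le> 1" | "1 < r" using r by linarith
  then show ?thesis
  proof cases
    case 2
    have "- ln r = ln (1 / r)" using 2 by (simp add: ln_div)
    also have "\<dots> \<le> 1 / r" using 2 by (intro ln_bound) simp
    finally have "r * (- ln r) \<le> r * (1 / r)" using 2 by (intro mult_left_mono) auto
    moreover have "ln r \<le> 0" using 2 by simp
    ultimately show ?thesis using 2 by (simp add: abs_mult) (smt (verit) zero_le_power2)
  next
    case 3
    then have "0 \<le> ln r" "ln r \<le> r" using ln_bound[of r] by auto
    then have "r * ln r \<le> r * r" using 3 by (intro mult_left_mono) auto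
    moreover have "\<bar>r * ln r\<bar> = r * ln r" using 3 \<open>0 \<le> ln r\<close> by simp
    ultimately show ?thesis by (simp add: power2_eq_square)
  qed simp
qed

text \<open>In polar coordinates the integrand becomes \<open>r * ln r\<close>, which is bounded on
  bounded sets.\<close>

lemma integrable_ln_norm_plane:
  "integrable lborel (\<lambda>z :: real \<times> real. indicator (cball 0 R) z * ln (norm z))"
proof -
  define f where "f z = indicator (cball 0 R) z * ln (norm z)" for z :: "real \<times> real"
  have [measurable]: "f \<in> borel_measurable borel"
    unfolding f_def
    by (intro borel_measurable_times borel_measurable_indicator borel_measurable_ln) simp_all
  have fg: "f (r * cos t, r * sin t) = (if r \<le> R then ln r else 0)" if "0 \<le> r" for r t
  proof -
    have "(r * cos t)\<^sup>2 + (r * sin t)\<^sup>2 = r\<^sup>2 * ((cos t)\<^sup>2 + (sin t)\<^sup>2)" by algebra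
    then have "norm (r * cos t, r * sin t) = r" using that by (simp add: norm_Pair)
    then show ?thesis by (auto simp: f_def indicator_def)
  qed
  let ?P = "\<lambda>z. indicator ({0..} \<times> {0..2*pi}) z * (fst z * f (fst z * cos (snd z), fst z * sin (snd z)))"
  let ?B = "\<lambda>z :: real \<times> real. indicator (cbox (0, 0) (R, 2*pi)) z * (1 + R\<^sup>2)"
  have Pm: "?P \<in> borel_measurable borel"
  proof -
    have "(\<lambda>z :: real \<times> real. (fst z * cos (snd z), fst z * sin (snd z))) \<in> borel_measurable borel"
      by (intro borel_measurable_continuous_onI continuous_intros)
    then have "(\<lambda>z :: real \<times> real. f (fst z * cos (snd z), fst z * sin (snd z))) \<in> borel_measurable borel"
      by measurable
    moreover have "{0..} \<times> {0..2*pi} \<in> sets (borel :: (real \<times> real) measure)"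
      by (intro borel_closed closed_Times) auto
    ultimately show ?thesis
      by (intro borel_measurable_times borel_measurable_indicator borel_measurable_fst_plane)
  qed
  have "integrable lborel ?P"
  proof (rule Bochner_Integration.integrable_bound)
    show "integrable lborel ?B"
      by (intro integrable_mult_left integrable_real_indicator) (use emeasure_lborel_cbox_finite in \<open>auto simp: top.not_eq_extremum\<close>)
    show "AE z in lborel. norm (?P z) \<le> norm (?B z)"
    proof (rule AE_I2)
      fix z :: "real \<times> real"
      show "norm (?P z) \<le> norm (?B z)"
      proof (cases "z \<in> {0..} \<times> {0..2*pi} \<and> fst z \<le> R")
        case True
        then have "z \<in> cbox (0, 0) (R, 2*pi)" by (cases z) (auto simp: cbox_Pair_eq)
        moreover have "\<bar>fst z * ln (fst z)\<bar> \<le> 1 + R\<^sup>2"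
        proof -
          have "0 \<le> fst z" "fst z \<le> R" using True by (auto simp: mem_Times_iff)
          then show ?thesis using abs_times_ln_le[of "fst z"] power_mono[of "fst z" R 2] by linarith
        qed
        ultimately show ?thesis using True by (auto simp: fg)
      next
        case False
        then show ?thesis by (cases "z \<in> {0..} \<times> {0..2*pi}") (auto simp: fg)
      qed
    qed
  qed (use Pm in simp)
  then have "integrable lborel f" using polar_coordinates(1)[of f] by simp
  then show ?thesis by (simp only: f_def[abs_def])
qed

section \<open>The Laplacian of the logarithmic potential\<close>

text \<open>By the mean value inequality \<open>B\<close> dominates the difference quotients as well
  as the derivative, so dominated convergence applies along every sequence of increments tending to
  0.\<close>

lemma has_real_derivative_integral_dominated:
  fixes f f' :: "real \<Rightarrow> 'a \<Rightarrow> real"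
  assumes int: "\<And>s. integrable M (f s)"
    and der: "\<And>s z. ((\<lambda>s. f s z) has_real_derivative f' s z) (at s)"
    and bd: "\<And>s z. \<bar>s - a\<bar> \<le> 1 \<Longrightarrow> \<bar>f' s z\<bar> \<le> B z"
    and B: "integrable M B" and m [measurable]: "f' a \<in> borel_measurable M"
  shows "((\<lambda>s. \<integral>z. f s z \<partial>M) has_real_derivative (\<integral>z. f' a z \<partial>M)) (at a)"
proof -
  define q where "q h z = (f (a + h) z - f a z) / h" for h z
  have fm [measurable]: "f s \<in> borel_measurable M" for s using int by auto
  have q_bd: "norm (q h z) \<le> B z" if "\<bar>h\<bar> \<le> 1" "h \<noteq> 0" for h z
  proof -
    have "norm (f (a + h) z - f a z) \<le> B z * norm (a + h - a)"
    proof (rule field_differentiable_bound[of "{a-1..a+1}" "\<lambda>s. f s z" "\<lambda>s. f' s z"])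
      show "((\<lambda>s. f s z) has_real_derivative f' s z) (at s within {a-1..a+1})" for s
        by (rule has_field_derivative_at_within[OF der])
      show "norm (f' s z) \<le> B z" if "s \<in> {a-1..a+1}" for s
        using bd[of s z] that by (auto simp: abs_le_iff)
    qed (use that in auto)
    then show ?thesis using that by (simp add: q_def field_simps)
  qed
  have "((\<lambda>h. \<integral>z. q h z \<partial>M) \<longlongrightarrow> (\<integral>z. f' a z \<partial>M)) (at 0)"
    unfolding tendsto_at_iff_sequentially
  proof (intro allI impI)
    fix X :: "nat \<Rightarrow> real" assume X0: "\<forall>i. X i \<in> UNIV - {0}" and X: "X \<longlonglongrightarrow> 0"
    from X have "\<forall>\<^sub>F i in sequentially. \<bar>X i\<bar> < 1"
      by (auto dest: tendstoD[of _ _ _ 1] simp: dist_real_def)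
    \<comment> \<open>The domination holds only for increments of size at most 1, so an initial
      segment of the sequence is dropped.\<close>
    then obtain N where N: "\<And>i. i \<ge> N \<Longrightarrow> \<bar>X i\<bar> < 1" unfolding eventually_sequentially by blast
    have "(\<lambda>i. \<integral>z. q (X (i + N)) z \<partial>M) \<longlonglongrightarrow> (\<integral>z. f' a z \<partial>M)"
    proof (rule integral_dominated_convergence[where w=B])
      show "AE z in M. (\<lambda>i. q (X (i + N)) z) \<longlonglongrightarrow> f' a z"
      proof (rule AE_I2)
        fix z
        have "((\<lambda>h. q h z) \<longlongrightarrow> f' a z) (at 0)"
          using der[of z a] unfolding DERIV_def q_def by simp
        then have "(\<lambda>i. q (X i) z) \<longlonglongrightarrow> f' a z"
          using X0 X unfolding tendsto_at_iff_sequentially o_def by blast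
        then show "(\<lambda>i. q (X (i + N)) z) \<longlonglongrightarrow> f' a z" by (rule LIMSEQ_ignore_initial_segment)
      qed
      show "AE z in M. norm (q (X (i + N)) z) \<le> B z" for i
        using X0 N[of "i + N"] by (intro AE_I2 q_bd) auto
      show "q (X (i + N)) \<in> borel_measurable M" for i unfolding q_def by measurable
    qed (use B in auto)
    then show "((\<lambda>h. \<integral>z. q h z \<partial>M) \<circ> X) \<longlonglongrightarrow> (\<integral>z. f' a z \<partial>M)"
      unfolding o_def by (rule LIMSEQ_offset)
  qed
  moreover have "(\<integral>z. q h z \<partial>M) = ((\<integral>z. f (a + h) z \<partial>M) - (\<integral>z. f a z \<partial>M)) / h" for h
    unfolding q_def using int by (simp add: Bochner_Integration.integral_diff)
  ultimately show ?thesis unfolding DERIV_def by simp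
qed

lemma bounded_of_vanishing_outside:
  fixes H :: "'a::euclidean_space \<Rightarrow> real"
  assumes "continuous_on UNIV H" "\<And>z. norm z > R \<Longrightarrow> H z = 0"
  obtains M where "0 \<le> M" "\<And>z. \<bar>H z\<bar> \<le> M"
proof -
  have "compact (H ` cball 0 R)"
    by (intro compact_continuous_image continuous_on_subset[OF assms(1)]) auto
  from compact_imp_bounded[OF this] obtain M where M: "\<forall>y \<in> H ` cball 0 R. norm y \<le> M"
    unfolding bounded_iff by (elim exE)
  have "\<bar>H z\<bar> \<le> \<bar>M\<bar>" for z
  proof (cases "norm z > R")
    case False
    then have "norm (H z) \<le> M" using M by (intro M[rule_format] imageI) (simp add: not_less)
    then show ?thesis by simp
  qed (simp add: assms(2))
  then show ?thesis using that[of "\<bar>M\<bar>"] by simp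
qed

text \<open>The potential at \<open>p\<close> after translation by \<open>p\<close>: the singularity
  stays at the origin and \<open>p\<close> occurs only in the regular factor. The support of that
  factor confines \<open>z\<close> to the ball of radius \<open>R + norm p\<close>.\<close>

lemma integrable_log_potential:
  fixes H :: "real \<times> real \<Rightarrow> real"
  assumes H: "continuous_on UNIV H" and supp: "\<And>z. norm z > R \<Longrightarrow> H z = 0"
  shows "integrable lborel (\<lambda>z. H (p + z) * ln (norm z))"
proof -
  obtain M where M: "0 \<le> M" "\<And>z. \<bar>H z\<bar> \<le> M" using bounded_of_vanishing_outside[OF H supp] by blast
  let ?L = "\<lambda>z :: real \<times> real. indicator (cball 0 (R + norm p)) z * ln (norm z)"
  show ?thesis
  proof (rule Bochner_Integration.integrable_bound)
    show "integrable lborel (\<lambda>z. M * ?L z)"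
      by (intro integrable_mult_right integrable_ln_norm_plane)
    have "(\<lambda>z. H (p + z)) \<in> borel_measurable borel"
      by (intro borel_measurable_continuous_onI continuous_on_compose2[OF H] continuous_intros) auto
    then show "(\<lambda>z. H (p + z) * ln (norm z)) \<in> borel_measurable lborel"
      by (intro borel_measurable_times borel_measurable_ln) simp_all
    show "AE z in lborel. norm (H (p + z) * ln (norm z)) \<le> norm (M * ?L z)"
    proof (rule AE_I2)
      fix z
      show "norm (H (p + z) * ln (norm z)) \<le> norm (M * ?L z)"
      proof (cases "z \<in> cball 0 (R + norm p)")
        case True
        have "\<bar>H (p + z)\<bar> * \<bar>ln (norm z)\<bar> \<le> M * \<bar>ln (norm z)\<bar>"
          by (intro mult_right_mono M) auto
        then show ?thesis using True M(1) by (simp add: abs_mult)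
      next
        case False
        then have "norm (p + z) > R" using norm_triangle_ineq4[of "p + z" p] by simp
        then show ?thesis by (simp add: supp)
      qed
    qed
  qed
qed

lemma has_derivative_zero_outside:
  fixes H :: "'a::real_normed_vector \<Rightarrow> real"
  assumes der: "(H has_derivative D) (at z)" and supp: "\<And>z. norm z > R \<Longrightarrow> H z = 0" and "norm z > R"
  shows "D = (\<lambda>_. 0)"
proof -
  have "((\<lambda>_. 0) has_derivative D) (at z)"
  proof (rule has_derivative_transform_within_open[OF der])
    show "open {z. norm z > R}" by (intro open_Collect_less continuous_intros)
  qed (use assms in auto)
  then show ?thesis using has_derivative_unique has_derivative_const by blast
qed

text \<open>The derivative falls on the density, never on the logarithm. It is applied first to the
  density and then to its directional derivatives, which have the same bound on their
  support.\<close>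

lemma log_potential_has_real_derivative:
  fixes H :: "real \<times> real \<Rightarrow> real"
  assumes der: "\<And>z. (H has_derivative D z) (at z)"
    and cont: "continuous_on UNIV (\<lambda>z. D z e)"
    and supp: "\<And>z. norm z > R \<Longrightarrow> H z = 0"
  shows "((\<lambda>s. \<integral>z. H (p + s *\<^sub>R e + z) * ln (norm z) \<partial>lborel) has_real_derivative
          (\<integral>z. D (p + a *\<^sub>R e + z) e * ln (norm z) \<partial>lborel)) (at a)"
proof -
  have contH: "continuous_on UNIV H"
    by (rule has_derivative_continuous_on[OF der])
  have supp': "D z e = 0" if "norm z > R" for z
    using has_derivative_zero_outside[OF der supp that] by simp
  obtain M where M: "0 \<le> M" "\<And>z. \<bar>D z e\<bar> \<le> M" using bounded_of_vanishing_outside[OF cont supp'] by blast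
  \<comment> \<open>A radius that contains the supports of all the shifted densities with
    \<open>\<bar>s - a\<bar> \<le> 1\<close>, so that one dominating function serves them
    all.\<close>
  define Q where "Q = R + norm p + (\<bar>a\<bar> + 1) * norm e"
  show ?thesis
  proof (rule has_real_derivative_integral_dominated[where B = "\<lambda>z. \<bar>M * (indicator (cball 0 Q) z * ln (norm z))\<bar>"
      and f' = "\<lambda>s z. D (p + s *\<^sub>R e + z) e * ln (norm z)"])
    show "integrable lborel (\<lambda>z. H (p + s *\<^sub>R e + z) * ln (norm z))" for s
      by (rule integrable_log_potential[OF contH supp])
    have int': "integrable lborel (\<lambda>z. D (p + a *\<^sub>R e + z) e * ln (norm z))"
      by (rule integrable_log_potential[OF cont supp'])
    then show "(\<lambda>z. D (p + a *\<^sub>R e + z) e * ln (norm z)) \<in> borel_measurable lborel" by auto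
    show "integrable lborel (\<lambda>z::real \<times> real. \<bar>M * (indicator (cball 0 Q) z * ln (norm z))\<bar>)"
      by (intro integrable_abs integrable_mult_right integrable_ln_norm_plane)
    show "((\<lambda>s. H (p + s *\<^sub>R e + z) * ln (norm z)) has_real_derivative D (p + s *\<^sub>R e + z) e * ln (norm z)) (at s)" for s z
    proof -
      have "((\<lambda>s. p + s *\<^sub>R e + z) has_derivative (\<lambda>h. h *\<^sub>R e)) (at s)"
        by (auto intro!: derivative_eq_intros)
      from has_derivative_compose[OF this der]
      have "((\<lambda>s. H (p + s *\<^sub>R e + z)) has_derivative (\<lambda>h. D (p + s *\<^sub>R e + z) (h *\<^sub>R e))) (at s)" .
      moreover have "D (p + s *\<^sub>R e + z) (h *\<^sub>R e) = D (p + s *\<^sub>R e + z) e * h" for h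
        using has_derivative_linear[OF der] by (simp add: linear_cmul)
      ultimately have "((\<lambda>s. H (p + s *\<^sub>R e + z)) has_real_derivative D (p + s *\<^sub>R e + z) e) (at s)"
        by (simp add: has_field_derivative_def)
      then show ?thesis by (rule DERIV_cmult_right)
    qed
    show "\<bar>D (p + s *\<^sub>R e + z) e * ln (norm z)\<bar> \<le> \<bar>M * (indicator (cball 0 Q) z * ln (norm z))\<bar>"
      if s: "\<bar>s - a\<bar> \<le> 1" for s z
    proof (cases "z \<in> cball 0 Q")
      case True
      have "\<bar>D (p + s *\<^sub>R e + z) e\<bar> * \<bar>ln (norm z)\<bar> \<le> M * \<bar>ln (norm z)\<bar>"
        by (intro mult_right_mono M) auto
      then show ?thesis using True M(1) by (simp add: abs_mult)
    next
      case False
      have "\<bar>s\<bar> \<le> \<bar>a\<bar> + 1" using s by linarith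
      then have "norm (s *\<^sub>R e) \<le> (\<bar>a\<bar> + 1) * norm e" by (simp add: mult_right_mono)
      then have "norm (p + s *\<^sub>R e) \<le> norm p + (\<bar>a\<bar> + 1) * norm e"
        using norm_triangle_ineq[of p "s *\<^sub>R e"] by linarith
      then have "norm (p + s *\<^sub>R e + z) > R"
        using False norm_triangle_ineq4[of "p + s *\<^sub>R e + z" "p + s *\<^sub>R e"] by (simp add: Q_def)
      then show ?thesis by (simp add: supp')
    qed
  qed
qed

section \<open>The fundamental solution: evaluating the Laplacian of the potential\<close>

lemma has_real_derivative_along_curve:
  fixes f fx fy :: "real \<times> real \<Rightarrow> real" and c :: "real \<Rightarrow> real \<times> real"
  assumes c: "(c has_derivative (\<lambda>h. (h * x, h * y))) (at t)"
    and f: "\<And>z. (f has_derivative (\<lambda>h. fst h * fx z + snd h * fy z)) (at z)"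
  shows "((\<lambda>t. f (c t)) has_real_derivative (x * fx (c t) + y * fy (c t))) (at t)"
  unfolding has_field_derivative_def
  by (rule has_derivative_eq_rhs[OF has_derivative_compose[OF c f]]) (simp add: fun_eq_iff algebra_simps)

text \<open>For fixed radius the angular part integrates to zero over a full turn. For fixed angle
  the radial part is integrated by parts against \<open>ln r\<close>: everything vanishes at large
  radius, and the lower limit leaves \<open>F p\<close>. Integrating this constant over the angles
  gives the factor \<open>2 * pi\<close>.\<close>

lemma log_potential_laplacian_integral:
  fixes F a b ax ay bx by' :: "real \<times> real \<Rightarrow> real"
  assumes F: "\<And>z. (F has_derivative (\<lambda>h. fst h * a z + snd h * b z)) (at z)"
    and a: "\<And>z. (a has_derivative (\<lambda>h. fst h * ax z + snd h * ay z)) (at z)"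
    and b: "\<And>z. (b has_derivative (\<lambda>h. fst h * bx z + snd h * by' z)) (at z)"
    and cont: "continuous_on UNIV ax" "continuous_on UNIV ay" "continuous_on UNIV bx" "continuous_on UNIV by'"
    and supp: "\<And>z. norm z > R \<Longrightarrow> F z = 0"
  shows "(\<integral>z. (ax (p + z) + by' (p + z)) * ln (norm z) \<partial>lborel) = 2 * pi * F p"
proof -
  have contF: "continuous_on UNIV F" and conta: "continuous_on UNIV a" and contb: "continuous_on UNIV b"
    by (rule has_derivative_continuous_on[OF F] has_derivative_continuous_on[OF a] has_derivative_continuous_on[OF b])+
  have sa: "a z = 0" and sb: "b z = 0" if "norm z > R" for z
    using fun_cong[OF has_derivative_zero_outside[OF F supp that], of "(1,0)"]
      fun_cong[OF has_derivative_zero_outside[OF F supp that], of "(0,1)"] by simp_all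
  have sax: "ax z = 0" and say: "ay z = 0" if "norm z > R" for z
    using fun_cong[OF has_derivative_zero_outside[OF a sa that], of "(1,0)"]
      fun_cong[OF has_derivative_zero_outside[OF a sa that], of "(0,1)"] by simp_all
  have sbx: "bx z = 0" and sby: "by' z = 0" if "norm z > R" for z
    using fun_cong[OF has_derivative_zero_outside[OF b sb that], of "(1,0)"]
      fun_cong[OF has_derivative_zero_outside[OF b sb that], of "(0,1)"] by simp_all
  \<comment> \<open>From radius \<open>Q\<close> on, the circle about \<open>p\<close> lies outside
    the ball of radius \<open>R\<close>; the summand 1 also makes \<open>Q\<close> positive.\<close>
  define Q where "Q = \<bar>R\<bar> + norm p + 1"
  have Q: "Q > 0" by (simp add: Q_def add_nonneg_pos)
  define P where "P z = p + (fst z * cos (snd z), fst z * sin (snd z))" for z :: "real \<times> real"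
  have contP: "continuous_on S P" for S unfolding P_def by (intro continuous_intros)
  have nP: "norm (fst z * cos (snd z), fst z * sin (snd z)) = \<bar>fst z\<bar>" for z :: "real \<times> real"
  proof -
    have "(fst z * cos (snd z))\<^sup>2 + (fst z * sin (snd z))\<^sup>2 = (fst z)\<^sup>2 * ((cos (snd z))\<^sup>2 + (sin (snd z))\<^sup>2)"
      by algebra
    then show ?thesis by (simp add: norm_Pair)
  qed
  have outside: "norm (P z) > R" if "fst z \<ge> Q" for z
  proof -
    have "fst z \<le> norm (P z) + norm p"
      using norm_triangle_ineq4[of "P z" p] nP[of z] that Q by (simp add: P_def)
    then show ?thesis using that by (simp add: Q_def)
  qed
  text \<open>In polar coordinates around \<open>p\<close> the Laplacian times \<open>r\<close> splits into an angular derivative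
    \<open>V\<close> and the radial derivative \<open>U\<close> of \<open>r F\<^sub>r\<close>.\<close>
  define V where "V z = - cos (snd z) * a (P z) - sin (snd z) * b (P z)
      - sin (snd z) * (fst z * (- sin (snd z) * ax (P z) + cos (snd z) * ay (P z)))
      + cos (snd z) * (fst z * (- sin (snd z) * bx (P z) + cos (snd z) * by' (P z)))" for z
  define W where "W z = cos (snd z) * a (P z) + sin (snd z) * b (P z)" for z
  define U where "U z = W z + fst z * (cos (snd z) * (cos (snd z) * ax (P z) + sin (snd z) * ay (P z))
      + sin (snd z) * (cos (snd z) * bx (P z) + sin (snd z) * by' (P z)))" for z
  have comp: "continuous_on S (\<lambda>z. g (P z))" if "continuous_on UNIV g" for S and g :: "real \<times> real \<Rightarrow> real"
    using that contP by (rule continuous_on_compose2) auto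
  note comps = comp[OF contF] comp[OF conta] comp[OF contb] comp[OF cont(1)] comp[OF cont(2)] comp[OF cont(3)] comp[OF cont(4)]
  have contV: "continuous_on S V" for S unfolding V_def by (intro continuous_intros comps)
  have contU: "continuous_on S U" for S unfolding U_def W_def by (intro continuous_intros comps)
  \<comment> \<open>The first-order terms of \<open>V\<close> and \<open>U\<close> cancel, the
    \<open>ay\<close> terms cancel one another, and so do the \<open>bx\<close> terms. What remains
    is collected by the Pythagorean identity.\<close>
  have split: "fst z * (ax (P z) + by' (P z)) = V z + U z" for z
  proof -
    have "(cos (snd z))\<^sup>2 + (sin (snd z))\<^sup>2 = 1" by simp
    then show ?thesis unfolding V_def U_def W_def by algebra
  qed
  let ?B = "{0..Q} \<times> {0..2*pi}"
  have lnQ: "integrable lborel (\<lambda>r::real. indicator {0..Q} r * ln r)"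
  proof -
    have eq: "indicator {0..Q} r * ln \<bar>r - 0\<bar> = indicator {0..Q} r * ln r" for r :: real
      by (auto simp: indicator_def)
    show ?thesis using integrable_indicator_ln_abs[of 0 Q 0] unfolding eq .
  qed
  have intV: "integrable lborel (\<lambda>z. indicator ?B z * (V z * ln (fst z)))"
    by (rule integrable_times_fst[OF contV lnQ])
  have intU: "integrable lborel (\<lambda>z. indicator ?B z * (U z * ln (fst z)))"
    by (rule integrable_times_fst[OF contU lnQ])
  have polar: "indicator ({0..} \<times> {0..2*pi}) z *
      (fst z * ((ax (P z) + by' (P z)) * ln (norm (fst z * cos (snd z), fst z * sin (snd z))))) =
      indicator ?B z * (V z * ln (fst z)) + indicator ?B z * (U z * ln (fst z))" for z
  proof (cases "z \<in> ?B")
    case True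
    then have "0 \<le> fst z" by (simp add: mem_Times_iff)
    then have "fst z * ((ax (P z) + by' (P z)) * ln (norm (fst z * cos (snd z), fst z * sin (snd z)))) =
      (V z + U z) * ln (fst z)"
      unfolding nP split[symmetric] by simp
    then show ?thesis using True by (simp add: mem_Times_iff algebra_simps)
  next
    case False
    then have "z \<notin> {0..} \<times> {0..2*pi} \<or> fst z \<ge> Q" by (auto simp: mem_Times_iff)
    then show ?thesis
    proof
      assume "fst z \<ge> Q"
      from sax[OF outside[OF this]] sby[OF outside[OF this]] show ?thesis using False by simp
    qed (use False in simp)
  qed
  have meas: "(\<lambda>z. (ax (p + z) + by' (p + z)) * ln (norm z)) \<in> borel_measurable borel"
    by (intro borel_measurable_times borel_measurable_ln borel_measurable_continuous_onI continuous_intros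
        continuous_on_compose2[OF cont(1)] continuous_on_compose2[OF cont(4)]) auto
  have "(\<integral>z. (ax (p + z) + by' (p + z)) * ln (norm z) \<partial>lborel) =
    (\<integral>z. indicator ?B z * (V z * ln (fst z)) + indicator ?B z * (U z * ln (fst z)) \<partial>lborel)"
    unfolding polar_coordinates(2)[OF meas] P_def[symmetric] polar ..
  also have "\<dots> = (\<integral>z. indicator ?B z * (V z * ln (fst z)) \<partial>lborel) + (\<integral>z. indicator ?B z * (U z * ln (fst z)) \<partial>lborel)"
    by (rule Bochner_Integration.integral_add[OF intV intU])
  also have "(\<integral>z. indicator ?B z * (V z * ln (fst z)) \<partial>lborel) = 0"
  proof -
    have "(\<integral>z. indicator ?B z * (V z * ln (fst z)) \<partial>lborel) =
       (\<integral>r. (\<integral>t. indicator ?B (r, t) * (V (r, t) * ln r) \<partial>lborel) \<partial>lborel)"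
      using lborel_pair.integral_fst'[of "\<lambda>z. indicator ?B z * (V z * ln (fst z))"] intV
      by (simp add: lborel_prod)
    moreover have "(\<integral>t. indicator ?B (r, t) * (V (r, t) * ln r) \<partial>lborel) = 0" for r
    proof -
      \<comment> \<open>The antiderivative is the angular derivative of \<open>F\<close> along the
        circle divided by \<open>r\<close>, written without a division so that it is also meaningful
        at \<open>r = 0\<close>. It has period \<open>2*pi\<close>.\<close>
      have "(\<integral>t. V (r, t) * indicator {0..2*pi} t \<partial>lborel) =
          (- sin (2*pi) * a (P (r, 2*pi)) + cos (2*pi) * b (P (r, 2*pi))) - (- sin 0 * a (P (r, 0)) + cos 0 * b (P (r, 0)))"
      proof (rule integral_FTC_Icc_real)
        fix t :: real
        have Pd: "((\<lambda>t. P (r, t)) has_derivative (\<lambda>h. (h * (- r * sin t), h * (r * cos t)))) (at t)"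
          unfolding P_def by (auto intro!: derivative_eq_intros)
        have "((\<lambda>t. a (P (r, t))) has_real_derivative (- r * sin t) * ax (P (r, t)) + (r * cos t) * ay (P (r, t))) (at t)"
          by (rule has_real_derivative_along_curve[OF Pd a])
        moreover have "((\<lambda>t. b (P (r, t))) has_real_derivative (- r * sin t) * bx (P (r, t)) + (r * cos t) * by' (P (r, t))) (at t)"
          by (rule has_real_derivative_along_curve[OF Pd b])
        ultimately show "((\<lambda>t. - sin t * a (P (r, t)) + cos t * b (P (r, t))) has_real_derivative V (r, t)) (at t)"
          by (auto intro!: derivative_eq_intros simp: V_def algebra_simps)
        have "continuous_on UNIV (\<lambda>t. V (r, t))"
          by (rule continuous_on_compose2[OF contV[of UNIV]]) (auto intro!: continuous_intros)
        then show "isCont (\<lambda>t. V (r, t)) t" by (simp add: continuous_on_eq_continuous_at)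
      qed simp
      also have "\<dots> = 0" by (simp add: P_def)
      finally have 0: "(\<integral>t. V (r, t) * indicator {0..2*pi} t \<partial>lborel) = 0" .
      have eq: "indicator ?B (r, t) * (V (r, t) * ln r) = (indicator {0..Q} r * ln r) * (V (r, t) * indicator {0..2*pi} t)" for t
        by (auto simp: indicator_def)
      show ?thesis unfolding eq using 0 by simp
    qed
    ultimately show ?thesis by simp
  qed
  also have "(\<integral>z. indicator ?B z * (U z * ln (fst z)) \<partial>lborel) = 2 * pi * F p"
  proof -
    have "(\<integral>z. indicator ?B z * (U z * ln (fst z)) \<partial>lborel) =
       (\<integral>t. (\<integral>r. indicator ?B (r, t) * (U (r, t) * ln r) \<partial>lborel) \<partial>lborel)"
      using lborel_pair.integral_snd[of "\<lambda>r t. indicator ?B (r, t) * (U (r, t) * ln r)"] intU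
      by (simp add: lborel_prod case_prod_unfold)
    moreover have "(\<integral>r. indicator ?B (r, t) * (U (r, t) * ln r) \<partial>lborel) = indicator {0..2*pi} t * F p" for t
    proof -
      have Ut: "continuous_on S (\<lambda>r. U (r, t))" for S
        by (rule continuous_on_compose2[OF contU[of UNIV]]) (auto intro!: continuous_intros)
      \<comment> \<open>Integration by parts: \<open>U\<close> is the radial derivative of
        \<open>r * W\<close>, and \<open>W\<close> is the radial derivative of \<open>F\<close>, so
        \<open>(r * ln r) * W - F\<close> is an antiderivative. At 0 its first term vanishes and its
        second is \<open>- F p\<close>.\<close>
      have "((\<lambda>r. U (r, t) * ln r) has_integral
          ((Q * ln Q) * W (Q, t) - F (P (Q, t))) - ((0 * ln 0) * W (0, t) - F (P (0, t)))) {0..Q}"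
      proof (rule fundamental_theorem_of_calculus_interior)
        have "continuous_on {0..Q} (\<lambda>r. W (r, t))" unfolding W_def
          by (intro continuous_intros continuous_on_compose2[OF comps(2)[of UNIV], of "{0..Q}" "\<lambda>r. (r, t)", simplified]
            continuous_on_compose2[OF comps(3)[of UNIV], of "{0..Q}" "\<lambda>r. (r, t)", simplified])
        moreover have "continuous_on {0..Q} (\<lambda>r. F (P (r, t)))"
          by (intro continuous_intros continuous_on_compose2[OF comps(1)[of UNIV], of "{0..Q}" "\<lambda>r. (r, t)", simplified])
        ultimately show "continuous_on {0..Q} (\<lambda>r. (r * ln r) * W (r, t) - F (P (r, t)))"
          by (intro continuous_on_diff continuous_on_mult continuous_on_subset[OF continuous_on_times_ln]) auto
      next
        fix r assume r: "r \<in> {0<..<Q}"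
        have Pd: "((\<lambda>r. P (r, t)) has_derivative (\<lambda>h. (h * cos t, h * sin t))) (at r)"
          unfolding P_def by (auto intro!: derivative_eq_intros)
        have Fd: "((\<lambda>r. F (P (r, t))) has_real_derivative cos t * a (P (r, t)) + sin t * b (P (r, t))) (at r)"
          by (rule has_real_derivative_along_curve[OF Pd F])
        have ad: "((\<lambda>r. a (P (r, t))) has_real_derivative cos t * ax (P (r, t)) + sin t * ay (P (r, t))) (at r)"
          by (rule has_real_derivative_along_curve[OF Pd a])
        have bd: "((\<lambda>r. b (P (r, t))) has_real_derivative cos t * bx (P (r, t)) + sin t * by' (P (r, t))) (at r)"
          by (rule has_real_derivative_along_curve[OF Pd b])
        have "((\<lambda>r. (r * ln r) * (cos t * a (P (r, t)) + sin t * b (P (r, t))) - F (P (r, t))) has_real_derivative U (r, t) * ln r) (at r)"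
          by (rule derivative_eq_intros Fd ad bd refl | use r in \<open>simp; fail\<close>)+
             (use r in \<open>simp add: U_def W_def field_simps\<close>)
        then show "((\<lambda>r. (r * ln r) * W (r, t) - F (P (r, t))) has_vector_derivative U (r, t) * ln r) (at r)"
          by (simp add: has_real_derivative_iff_has_vector_derivative W_def)
      qed (use Q in simp)
      moreover have "W (Q, t) = 0" "F (P (Q, t)) = 0"
        using outside[of "(Q, t)"] sa sb supp by (simp_all add: W_def)
      moreover have "P (0, t) = p" by (simp add: P_def zero_prod_def[symmetric])
      ultimately have hi: "((\<lambda>r. U (r, t) * ln r) has_integral F p) {0..Q}" by simp
      \<comment> \<open>Lebesgue integrability identifies the gauge integral just computed with the
        \<open>lborel\<close> integral; \<open>U\<close> is bounded on the segment, so the logarithm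
        dominates.\<close>
      have "set_integrable lborel {0..Q} (\<lambda>r. U (r, t) * ln r)"
      proof -
        have "compact ((\<lambda>r. U (r, t)) ` {0..Q})" by (intro compact_continuous_image Ut compact_Icc)
        from compact_imp_bounded[OF this] obtain M where M: "\<forall>y \<in> (\<lambda>r. U (r, t)) ` {0..Q}. norm y \<le> M"
          unfolding bounded_iff by (elim exE)
        have "integrable lborel (\<lambda>r. M * (indicator {0..Q} r * ln r))"
          by (intro integrable_mult_right lnQ)
        moreover have "(\<lambda>r. indicator {0..Q} r *\<^sub>R (U (r, t) * ln r)) \<in> borel_measurable lborel"
        proof -
          have "(\<lambda>r. U (r, t)) \<in> borel_measurable lborel"
            using borel_measurable_continuous_onI[OF Ut] by simp
          then show ?thesis unfolding real_scaleR_def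
            by (intro borel_measurable_times borel_measurable_indicator borel_measurable_ln) auto
        qed
        moreover have "norm (indicator {0..Q} r *\<^sub>R (U (r, t) * ln r)) \<le> norm (M * (indicator {0..Q} r * ln r))" for r
        proof (cases "r \<in> {0..Q}")
          case True
          then have "\<bar>U (r, t)\<bar> \<le> \<bar>M\<bar>" using M by force
          then have "\<bar>U (r, t)\<bar> * \<bar>ln r\<bar> \<le> \<bar>M\<bar> * \<bar>ln r\<bar>" by (rule mult_right_mono) simp
          then show ?thesis using True by (simp add: abs_mult)
        qed simp
        ultimately show ?thesis unfolding set_integrable_def
          by (blast intro: Bochner_Integration.integrable_bound)
      qed
      from set_borel_integral_eq_integral(2)[OF this] hi
      have Fp: "(\<integral>r. indicator {0..Q} r * (U (r, t) * ln r) \<partial>lborel) = F p"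
        by (simp add: set_lebesgue_integral_def integral_unique)
      have eq: "indicator ?B (r, t) * (U (r, t) * ln r) = indicator {0..2*pi} t * (indicator {0..Q} r * (U (r, t) * ln r))" for r
        by (auto simp: indicator_def)
      show ?thesis unfolding eq using Fp by simp
    qed
    ultimately show ?thesis by simp
  qed
  finally show ?thesis by simp
qed

lemma lborel_integral_translate:
  fixes f :: "'a::euclidean_space \<Rightarrow> real"
  assumes [measurable]: "f \<in> borel_measurable borel"
  shows "(\<integral>z. f (c + z) \<partial>lborel) = integral\<^sup>L lborel f"
proof -
  have "integral\<^sup>L lborel f = integral\<^sup>L (distr lborel borel ((+) c)) f"
    by (simp add: lborel_distr_plus)
  also have "\<dots> = (\<integral>z. f (c + z) \<partial>lborel)" by (rule integral_distr) auto
  finally show ?thesis by simp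
qed

text \<open>Here \<open>D z v\<close> is the derivative of \<open>F\<close> in direction
  \<open>v\<close>, and \<open>E v z w\<close> that of \<open>D z v\<close> in direction
  \<open>w\<close>. Differentiating the translated potential twice along each axis turns its
  Laplacian into the potential of the Laplacian of \<open>F\<close>, whose value is already
  known.\<close>

lemma has_laplacian_log_potential:
  fixes F :: "real \<times> real \<Rightarrow> real"
  assumes F: "Cn_on (Suc (Suc 0)) UNIV F" and supp: "\<And>z. norm z > R \<Longrightarrow> F z = 0"
  shows "has_laplacian (\<lambda>p. \<integral>y. F y * ln (norm (y - pair2 p)) \<partial>lborel) p (2 * pi * F (pair2 p))"
proof -
  obtain D where DC: "(\<forall>z\<in>UNIV. (F has_derivative D z) (at z)) \<and> (\<forall>v. Cn_on (Suc 0) UNIV (\<lambda>z. D z v))"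
    using F[unfolded Cn_on.simps(2)[of "Suc 0"]] by (rule exE)
  then have D: "\<And>z. (F has_derivative D z) (at z)" and C1: "\<And>v. Cn_on (Suc 0) UNIV (\<lambda>z. D z v)"
    by blast+
  obtain E where EC: "\<forall>v. (\<forall>z\<in>UNIV. ((\<lambda>z. D z v) has_derivative E v z) (at z)) \<and> (\<forall>w. continuous_on UNIV (\<lambda>z. E v z w))"
    using choice[OF allI[OF C1[unfolded Cn_on.simps]]] by (rule exE)
  then have E: "\<And>v z. ((\<lambda>z. D z v) has_derivative E v z) (at z)" and C0: "\<And>v w. continuous_on UNIV (\<lambda>z. E v z w)"
    by blast+
  have contF: "continuous_on UNIV F" using F by (rule Cn_on_imp_continuous_on)
  have contD: "continuous_on UNIV (\<lambda>z. D z v)" for v using C1 by (rule Cn_on_imp_continuous_on)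
  have suppD: "D z v = 0" if "norm z > R" for z v
    using has_derivative_zero_outside[OF D supp that] by simp
  have pot: "(\<integral>y. F y * ln (norm (y - q)) \<partial>lborel) = (\<integral>z. F (q + z) * ln (norm z) \<partial>lborel)" for q
  proof -
    have "(\<lambda>y. F y * ln (norm (y - q))) \<in> borel_measurable borel"
      by (intro borel_measurable_times borel_measurable_ln borel_measurable_continuous_onI contF continuous_intros)
    from lborel_integral_translate[OF this, of q] show ?thesis by simp
  qed
  define e where "e i = pair2 (axis i 1)" for i
  have e: "e 1 = (1, 0)" "e 2 = (0, 1)" by (simp_all add: e_def pair2_def axis_def)
  have shift: "pair2 (p + u *\<^sub>R axis i 1) = pair2 p + u *\<^sub>R e i" for u i
    using bounded_linear_pair2 by (simp add: e_def linear_simps)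
  have second: "second_partial (\<lambda>p. \<integral>y. F y * ln (norm (y - pair2 p)) \<partial>lborel) p i
     (\<integral>z. E (e i) (pair2 p + z) (e i) * ln (norm z) \<partial>lborel)" for i
    unfolding second_partial_def pot shift
  proof (intro exI conjI)
    show "\<forall>\<^sub>F s in nhds 0. ((\<lambda>u. \<integral>z. F (pair2 p + u *\<^sub>R e i + z) * ln (norm z) \<partial>lborel)
       has_real_derivative (\<integral>z. D (pair2 p + s *\<^sub>R e i + z) (e i) * ln (norm z) \<partial>lborel)) (at s)"
      by (intro always_eventually allI log_potential_has_real_derivative[OF D contD supp])
    show "((\<lambda>s. \<integral>z. D (pair2 p + s *\<^sub>R e i + z) (e i) * ln (norm z) \<partial>lborel) has_real_derivative
       (\<integral>z. E (e i) (pair2 p + z) (e i) * ln (norm z) \<partial>lborel)) (at 0)"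
    proof -
      have "((\<lambda>s. \<integral>z. D (pair2 p + s *\<^sub>R e i + z) (e i) * ln (norm z) \<partial>lborel) has_real_derivative
         (\<integral>z. E (e i) (pair2 p + 0 *\<^sub>R e i + z) (e i) * ln (norm z) \<partial>lborel)) (at 0)"
        by (rule log_potential_has_real_derivative[OF E C0 suppD])
      then show ?thesis by simp
    qed
  qed
  have lin: "l h = fst h * l (1, 0) + snd h * l (0, 1)" if "linear l" for l :: "real \<times> real \<Rightarrow> real" and h
  proof -
    have "h = fst h *\<^sub>R (1, 0) + snd h *\<^sub>R (0, 1)" by (simp add: prod_eq_iff)
    then have "l h = l (fst h *\<^sub>R (1, 0) + snd h *\<^sub>R (0, 1))" by simp
    then show ?thesis using that by (simp only: linear_add linear_cmul real_scaleR_def)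
  qed
  have "(\<integral>z. (E (e 1) (pair2 p + z) (e 1) + E (e 2) (pair2 p + z) (e 2)) * ln (norm z) \<partial>lborel) = 2 * pi * F (pair2 p)"
  proof (rule log_potential_laplacian_integral[where R=R and ay = "\<lambda>z. E (e 1) z (e 2)" and bx = "\<lambda>z. E (e 2) z (e 1)"])
    show "(F has_derivative (\<lambda>h. fst h * D z (e 1) + snd h * D z (e 2))) (at z)" for z
      unfolding e using lin[OF has_derivative_linear[OF D]]
      by (intro has_derivative_eq_rhs[OF D] ext)
    show "((\<lambda>z. D z (e 1)) has_derivative (\<lambda>h. fst h * E (e 1) z (e 1) + snd h * E (e 1) z (e 2))) (at z)" for z
      unfolding e using lin[OF has_derivative_linear[OF E]]
      by (intro has_derivative_eq_rhs[OF E] ext)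
    show "((\<lambda>z. D z (e 2)) has_derivative (\<lambda>h. fst h * E (e 2) z (e 1) + snd h * E (e 2) z (e 2))) (at z)" for z
      unfolding e using lin[OF has_derivative_linear[OF E]]
      by (intro has_derivative_eq_rhs[OF E] ext)
  qed (rule C0 | erule supp)+
  moreover have "integrable lborel (\<lambda>z. E (e i) (pair2 p + z) (e i) * ln (norm z))" for i
    using has_derivative_zero_outside[OF E suppD]
    by (intro integrable_log_potential[OF C0, of R]) auto
  ultimately have total: "(\<Sum>i\<in>UNIV. \<integral>z. E (e i) (pair2 p + z) (e i) * ln (norm z) \<partial>lborel) = 2 * pi * F (pair2 p)"
    by (simp add: sum_2 distrib_right)
  show ?thesis unfolding has_laplacian_def
    by (intro exI[of _ "\<lambda>i. \<integral>z. E (e i) (pair2 p + z) (e i) * ln (norm z) \<partial>lborel"] conjI allI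
        second total[symmetric])
qed

section \<open>Logarithmic means of trigonometric polynomials of degree one\<close>

text \<open>A crude form of Jordan's inequality: up to \<open>pi / 3\<close> the slope of the sine
  is at least 1/2, and beyond that the sine is at least 1/2 while \<open>x / 4\<close> is less than
  1/2. Any linear lower bound serves to make the logarithm of the sine integrable.\<close>

lemma sin_ge_quarter:
  assumes "0 \<le> x" "x \<le> pi / 2" shows "x / 4 \<le> sin x"
proof (cases "x \<le> pi / 3")
  case True
  show ?thesis
  proof (cases "x = 0")
    case False
    then have "0 < x" using assms by simp
    then obtain z where z: "0 < z" "z < x" "sin x - sin 0 = (x - 0) * cos z"
      using MVT2[of 0 x sin cos] DERIV_sin by blast
    have "cos (pi / 3) \<le> cos z" using z True by (intro cos_monotone_0_pi_le) auto
    then have "x * (1 / 2) \<le> x * cos z" using assms by (intro mult_left_mono) (auto simp: cos_60)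
    then show ?thesis using z assms by simp
  qed simp
next
  case False
  have "sin (pi / 6) \<le> sin x"
    using False assms by (intro sin_monotone_2pi_le) (auto simp: field_simps)
  then show ?thesis using assms pi_less_4 by (simp add: sin_30)
qed

text \<open>The sine of the half angle vanishes at both ends of the period and is bounded below by a
  multiple of the distance \<open>m\<close> to the nearer end, so the logarithms of the distances to
  the two ends dominate.\<close>

lemma integrable_ln_sin:
  "integrable lborel (\<lambda>t. indicator {0..<2*pi} t * ln \<bar>2 * sin (t / 2)\<bar>)"
proof (rule Bochner_Integration.integrable_bound)
  let ?B = "\<lambda>t. indicator {0..2*pi} t * ln 4 + \<bar>indicator {0..2*pi} t * ln \<bar>t - 0\<bar>\<bar> + \<bar>indicator {0..2*pi} t * ln \<bar>t - 2*pi\<bar>\<bar> :: real"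
  show "integrable lborel ?B"
    by (intro Bochner_Integration.integrable_add integrable_abs integrable_indicator_ln_abs
          integrable_mult_left integrable_real_indicator) (auto simp: emeasure_lborel_Icc_eq)
  show "(\<lambda>t. indicator {0..<2*pi} t * ln \<bar>2 * sin (t / 2)\<bar>) \<in> borel_measurable lborel"
    by (intro borel_measurable_times borel_measurable_indicator borel_measurable_ln borel_measurable_abs) auto
  show "AE t in lborel. norm (indicator {0..<2*pi} t * ln \<bar>2 * sin (t / 2)\<bar>) \<le> norm (?B t)"
  proof (rule AE_I2)
    fix t :: real
    show "norm (indicator {0..<2*pi} t * ln \<bar>2 * sin (t / 2)\<bar>) \<le> norm (?B t)"
    proof (cases "t \<in> {0<..<2*pi}")
      case True
      define m where "m = min t (2*pi - t)"
      have m: "0 < m" "m / 4 \<le> 2 * sin (t / 2)"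
      proof -
        show "0 < m" using True by (auto simp: m_def)
        show "m / 4 \<le> 2 * sin (t / 2)"
        proof (cases "t \<le> pi")
          case le: True
          then have "t / 2 / 4 \<le> sin (t / 2)" using True by (intro sin_ge_quarter) auto
          then show ?thesis by (simp add: m_def)
        next
          case False
          then have "(pi - t / 2) / 4 \<le> sin (pi - t / 2)" using True by (intro sin_ge_quarter) auto
          then show ?thesis by (simp add: m_def)
        qed
      qed
      then have pos: "0 < 2 * sin (t / 2)" by linarith
      have "ln m - ln 4 = ln (m / 4)" using m by (simp add: ln_div)
      also have "\<dots> \<le> ln (2 * sin (t / 2))" using m pos by (subst ln_le_cancel_iff) auto
      finally have lo: "ln m - ln 4 \<le> ln (2 * sin (t / 2))" .
      have "2 * sin (t / 2) \<le> 4" using sin_le_one[of "t / 2"] by linarith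
      then have up: "ln (2 * sin (t / 2)) \<le> ln 4" using pos by (subst ln_le_cancel_iff) auto
      have "- \<bar>ln t\<bar> - \<bar>ln (2*pi - t)\<bar> \<le> ln m" unfolding m_def min_def by (simp; linarith)
      then have "\<bar>ln (2 * sin (t / 2))\<bar> \<le> ln 4 + \<bar>ln t\<bar> + \<bar>ln (2*pi - t)\<bar>" using lo up by linarith
      moreover have "\<bar>t\<bar> = t" "\<bar>t - 2*pi\<bar> = 2*pi - t" using True by auto
      ultimately show ?thesis using True pos by simp
    next
      case False
      then show ?thesis by (cases "t = 0") (auto simp: indicator_def)
    qed
  qed
qed

text \<open>The shift is reduced modulo \<open>T\<close> to some \<open>d\<close> in
  \<open>[0, T)\<close>. The period is then cut at \<open>T - d\<close> and the two pieces are
  translated separately.\<close>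

lemma integral_period_shift:
  fixes f :: "real \<Rightarrow> real"
  assumes per: "\<And>x. f (x + T) = f x" and T: "0 < T"
    and f: "integrable lborel (\<lambda>x. indicator {0..<T} x * f x)"
  shows "integrable lborel (\<lambda>x. indicator {0..<T} x * f (x - c))"
    and "(\<integral>x. indicator {0..<T} x * f (x - c) \<partial>lborel) = (\<integral>x. indicator {0..<T} x * f x \<partial>lborel)"
proof -
  have perN: "f (x + real n * T) = f x" for x n
  proof (induction n)
    case (Suc n)
    have "f (x + real (Suc n) * T) = f ((x + real n * T) + T)" by (simp add: algebra_simps)
    then show ?case using Suc per by simp
  qed simp
  have perZ: "f (x + of_int k * T) = f x" for x and k :: int
  proof (cases "k \<ge> 0")
    case True then show ?thesis using perN[of x "nat k"] by simp
  next
    case False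
    then have "real (nat (- k)) = - of_int k" by simp
    then show ?thesis using perN[of "x + of_int k * T" "nat (- k)"] by (simp add: algebra_simps)
  qed
  define d where "d = c - of_int \<lfloor>c / T\<rfloor> * T"
  have d: "0 \<le> d" "d < T"
    unfolding d_def using T floor_divide_lower[OF T, of c] floor_divide_upper[OF T, of c]
    by (simp_all add: algebra_simps)
  have fd: "f (x - c) = f (x - d)" for x
    using perZ[of "x - c" "\<lfloor>c / T\<rfloor>"] by (simp add: d_def algebra_simps)
  let ?f = "\<lambda>x. indicator {0..<T} x * f x"
  define g where "g x = indicator {T - d..<T} x * f x" for x
  define h where "h x = indicator {0..<T - d} x * f x" for x
  have g: "g = (\<lambda>x. indicator {T - d..<T} x * ?f x)" and h: "h = (\<lambda>x. indicator {0..<T - d} x * ?f x)"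
    using d by (auto simp: g_def h_def indicator_def fun_eq_iff)
  have gi: "integrable lborel g" using integrable_mult_indicator[OF _ f, of "{T - d..<T}"] unfolding g by simp
  have hi: "integrable lborel h" using integrable_mult_indicator[OF _ f, of "{0..<T - d}"] unfolding h by simp
  \<comment> \<open>For \<open>x < d\<close> the shifted argument leaves the period on the left and
    is brought back by adding \<open>T\<close>, which is the piece \<open>g\<close>; for
    \<open>x \<ge> d\<close> it stays inside, which is the piece \<open>h\<close>.\<close>
  have split: "indicator {0..<T} x * f (x - c) = g ((T - d) + 1 * x) + h (- d + 1 * x)" for x
    using per[of "x - d"] d by (auto simp: fd g_def h_def indicator_def algebra_simps)
  have sum: "?f x = g x + h x" for x using d by (auto simp: g_def h_def indicator_def)
  have gi': "integrable lborel (\<lambda>x. g ((T - d) + 1 * x))" by (rule lborel_integrable_real_affine[OF gi]) simp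
  have hi': "integrable lborel (\<lambda>x. h (- d + 1 * x))" by (rule lborel_integrable_real_affine[OF hi]) simp
  show "integrable lborel (\<lambda>x. indicator {0..<T} x * f (x - c))"
    unfolding split using gi' hi' by (rule Bochner_Integration.integrable_add)
  have "(\<integral>x. g ((T - d) + 1 * x) \<partial>lborel) = integral\<^sup>L lborel g" "(\<integral>x. h (- d + 1 * x) \<partial>lborel) = integral\<^sup>L lborel h"
    using lborel_integral_translate[of g "T - d"] lborel_integral_translate[of h "- d"] gi hi
    by (auto simp: borel_measurable_integrable[where M=lborel, simplified])
  then show "(\<integral>x. indicator {0..<T} x * f (x - c) \<partial>lborel) = (\<integral>x. ?f x \<partial>lborel)"
    unfolding split sum using gi hi gi' hi' by (simp only: Bochner_Integration.integral_add)
qed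

text \<open>The integral over a period, not divided by its length. It is kept as a symbol because it
  enters only the additive constant that the Laplacian removes.\<close>

definition ln_sin_mean :: real where
  "ln_sin_mean = (\<integral>t. indicator {0..<2*pi} t * ln \<bar>2 * sin (t / 2)\<bar> \<partial>lborel)"

text \<open>After factorisation each half-angle factor is a translate of the same periodic function,
  so the phases drop out of the integral. As \<gamma> enters only through a phase, the result
  depends on the amplitude alone.\<close>

lemma ln_linear_trig_integral:
  fixes \<alpha> \<beta> \<gamma> A :: real
  assumes A: "A > 0" "A\<^sup>2 = \<alpha>\<^sup>2 + \<beta>\<^sup>2" and \<gamma>: "\<bar>\<gamma>\<bar> \<le> A"
  shows "integrable lborel (\<lambda>t. indicator {0..2*pi} t * ln \<bar>\<gamma> + \<alpha> * cos t + \<beta> * sin t\<bar>)"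
    and "(\<integral>t. indicator {0..2*pi} t * ln \<bar>\<gamma> + \<alpha> * cos t + \<beta> * sin t\<bar> \<partial>lborel) =
         2 * pi * (ln A - ln 2) + 2 * ln_sin_mean"
proof -
  define K where "K t = ln \<bar>2 * sin (t / 2)\<bar>" for t :: real
  have per: "K (t + 2*pi) = K t" for t
  proof -
    have "sin ((t + 2*pi) / 2) = - sin (t / 2)" using sin_periodic_pi[of "t / 2"] by (simp add: add_divide_distrib)
    then show ?thesis by (simp add: K_def)
  qed
  have K0: "integrable lborel (\<lambda>t. indicator {0..<2*pi} t * K t)" unfolding K_def by (rule integrable_ln_sin)
  have Kmean: "(\<integral>t. indicator {0..<2*pi} t * K t \<partial>lborel) = ln_sin_mean" unfolding K_def ln_sin_mean_def ..
  note Kc = integral_period_shift[OF per _ K0, simplified Kmean, simplified]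
  have "(\<alpha> / A)\<^sup>2 + (\<beta> / A)\<^sup>2 = 1" 
    unfolding power_divide add_divide_distrib[symmetric] A(2)[symmetric] using A(1) by simp
  then obtain \<psi> where \<psi>: "\<alpha> / A = cos \<psi>" "\<beta> / A = sin \<psi>" using sincos_total_2pi by metis
  then have \<psi>': "\<alpha> = A * cos \<psi>" "\<beta> = A * sin \<psi>" using A by (auto simp: field_simps)
  \<comment> \<open>The bound on \<open>\<bar>\<gamma>\<bar>\<close> is what makes this angle real;
    with it, \<open>\<gamma> + \<alpha> * cos t + \<beta> * sin t\<close> is \<open>A\<close> times
    a difference of two cosines.\<close>
  define \<omega> where "\<omega> = arccos (- \<gamma> / A)"
  have "cos \<omega> = - \<gamma> / A" unfolding \<omega>_def using \<gamma> A by (intro cos_arccos) (auto simp: field_simps abs_le_iff)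
  then have \<omega>: "\<gamma> = - A * cos \<omega>" using A by (simp add: field_simps)
  have prod: "\<gamma> + \<alpha> * cos t + \<beta> * sin t = - (A / 2) * (2 * sin ((t - (\<psi> - \<omega>)) / 2)) * (2 * sin ((t - (\<psi> + \<omega>)) / 2))" for t
  proof -
    have "\<gamma> + \<alpha> * cos t + \<beta> * sin t = A * (cos (t - \<psi>) - cos \<omega>)"
      by (simp add: \<omega> \<psi>' cos_diff algebra_simps)
    also have "cos (t - \<psi>) - cos \<omega> = 2 * sin ((t - \<psi> + \<omega>) / 2) * sin ((\<omega> - (t - \<psi>)) / 2)"
      by (rule cos_diff_cos)
    also have "sin ((\<omega> - (t - \<psi>)) / 2) = - sin ((t - (\<psi> + \<omega>)) / 2)"
      unfolding sin_minus[symmetric] by (rule arg_cong[of _ _ sin]) (simp add: field_simps)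
    finally show ?thesis by (simp add: algebra_simps)
  qed
  \<comment> \<open>Off these countable zero sets all factors are nonzero and the logarithm of the
    product splits into a sum.\<close>
  have null: "AE t in lborel. sin ((t - c) / 2) \<noteq> 0" for c :: real
  proof -
    have "{t. sin ((t - c) / 2) = 0} \<subseteq> range (\<lambda>i::int. c + 2 * (of_int i * pi))"
      by (auto simp: sin_zero_iff_int2 image_iff field_simps)
    then have "countable {t. sin ((t - c) / 2) = 0}" by (rule countable_subset) simp
    then have "{t. sin ((t - c) / 2) = 0} \<in> null_sets lborel" by (rule countable_imp_null_set_lborel)
    then show ?thesis by (rule AE_I') auto
  qed
  let ?r = "\<lambda>t. indicator {0..<2*pi} t * (ln A - ln 2) + indicator {0..<2*pi} t * K (t - (\<psi> - \<omega>)) + indicator {0..<2*pi} t * K (t - (\<psi> + \<omega>))"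
  let ?l = "\<lambda>t. indicator {0..2*pi} t * ln \<bar>\<gamma> + \<alpha> * cos t + \<beta> * sin t\<bar>"
  have ae: "AE t in lborel. ?l t = ?r t"
    using null[of "\<psi> - \<omega>"] null[of "\<psi> + \<omega>"] AE_lborel_singleton[of "2*pi"]
  proof eventually_elim
    case (elim t)
    have "ln \<bar>\<gamma> + \<alpha> * cos t + \<beta> * sin t\<bar> = ln A - ln 2 + K (t - (\<psi> - \<omega>)) + K (t - (\<psi> + \<omega>))"
      unfolding prod abs_mult K_def using elim A by (simp add: ln_mult ln_div)
    then show ?case using elim(3) by (auto simp: indicator_def algebra_simps)
  qed
  have ml: "?l \<in> borel_measurable lborel"
    by (intro borel_measurable_times borel_measurable_indicator borel_measurable_ln borel_measurable_abs) auto
  have i1: "integrable lborel (\<lambda>t. indicator {0..<2*pi} t * (ln A - ln 2))"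
    by (intro integrable_mult_left integrable_real_indicator) auto
  have i1v: "(\<integral>t. indicator {0..<2*pi} t * (ln A - ln 2) \<partial>lborel) = 2 * pi * (ln A - ln 2)" by simp
  have ri: "integrable lborel ?r" by (intro Bochner_Integration.integrable_add i1 Kc)
  have rv: "(\<integral>t. ?r t \<partial>lborel) = 2 * pi * (ln A - ln 2) + 2 * ln_sin_mean"
    using i1 Kc(1)[of "\<psi> - \<omega>"] Kc(1)[of "\<psi> + \<omega>"] i1v Kc(2)
    by (simp only: Bochner_Integration.integral_add Bochner_Integration.integrable_add)
  have mr: "?r \<in> borel_measurable lborel" using ri by (rule borel_measurable_integrable)
  show "integrable lborel ?l" using integrable_cong_AE[OF ml mr ae] ri by simp
  show "(\<integral>t. ?l t \<partial>lborel) = 2 * pi * (ln A - ln 2) + 2 * ln_sin_mean"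
    using integral_cong_AE[OF ml mr ae] rv by simp
qed

section \<open>Archimedean coordinates on the sphere\<close>

definition is_frame :: "real^3 \<Rightarrow> real^3 \<Rightarrow> real^3 \<Rightarrow> bool" where
  "is_frame n u v \<longleftrightarrow> norm n = 1 \<and> norm u = 1 \<and> norm v = 1 \<and> u \<bullet> v = 0 \<and> u \<bullet> n = 0 \<and> v \<bullet> n = 0"

lemma is_frame_inner:
  assumes "is_frame n u v"
  shows "n \<bullet> n = 1" "u \<bullet> u = 1" "v \<bullet> v = 1" "u \<bullet> v = 0" "u \<bullet> n = 0" "v \<bullet> n = 0"
    "v \<bullet> u = 0" "n \<bullet> u = 0" "n \<bullet> v = 0"
  using assms by (simp_all add: is_frame_def dot_square_norm inner_commute)

lemma is_frame_exists:
  assumes "norm n = 1" shows "\<exists>u v. is_frame n u v"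
proof -
  obtain S where S: "n \<in> S" "pairwise orthogonal S" "\<And>x. x \<in> S \<Longrightarrow> norm x = 1" "card S = DIM(real^3)"
    using vector_in_orthonormal_basis[OF assms] by metis
  then have "card S = 3" by simp
  then have "finite S" by (metis card.infinite zero_neq_numeral)
  then have "card (S - {n}) = 2" using S(1) \<open>card S = 3\<close> by simp
  then obtain u v where uv: "S - {n} = {u, v}" "u \<noteq> v" by (auto simp: card_2_iff)
  then have "u \<in> S" "v \<in> S" "u \<noteq> n" "v \<noteq> n" by auto
  then have "is_frame n u v"
    unfolding is_frame_def using S(1,3) uv(2) S(2)[unfolded pairwise_def orthogonal_def] assms by auto
  then show ?thesis by blast
qed

text \<open>The frame picked by \<open>SOME\<close> depends on \<open>n\<close> alone. One pair
  \<open>u\<close>, \<open>v\<close> therefore serves all centres, radii and integrands, and the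
  circles of all heights about \<open>n\<close> share a common longitude.\<close>

lemma circle_int_frame:
  assumes "norm n = 1"
  shows "\<exists>u v. is_frame n u v \<and> (\<forall>g c r. circle_int g c n r =
      integral {0..2*pi} (\<lambda>\<phi>. g (c + (r * cos \<phi>) *\<^sub>R u + (r * sin \<phi>) *\<^sub>R v) * r))"
proof -
  let ?P = "\<lambda>(u, v). norm u = 1 \<and> norm v = 1 \<and> u \<bullet> v = 0 \<and> u \<bullet> n = 0 \<and> v \<bullet> n = 0"
  define w where "w = (SOME w. ?P w)"
  have "\<exists>w. ?P w" using is_frame_exists[OF assms] by (auto simp: is_frame_def)
  then have "?P w" unfolding w_def by (rule someI_ex)
  then have "is_frame n (fst w) (snd w)" using assms by (auto simp: is_frame_def case_prod_unfold)
  moreover have "circle_int g c n r =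
      integral {0..2*pi} (\<lambda>\<phi>. g (c + (r * cos \<phi>) *\<^sub>R fst w + (r * sin \<phi>) *\<^sub>R snd w) * r)" for g c r
    unfolding circle_int_def w_def by (simp add: Let_def case_prod_unfold)
  ultimately show ?thesis by blast
qed

lemma frame_expand:
  assumes fr: "is_frame n u v"
  shows "w = (w \<bullet> n) *\<^sub>R n + (w \<bullet> u) *\<^sub>R u + (w \<bullet> v) *\<^sub>R v"
proof -
  note i = is_frame_inner[OF fr]
  have ne: "n \<noteq> u" "n \<noteq> v" "u \<noteq> v" using i by auto
  let ?B = "{n, u, v}"
  have orth: "pairwise orthogonal ?B" using i by (auto simp: pairwise_def orthogonal_def)
  have ind: "independent ?B"
    using i by (intro pairwise_orthogonal_independent[OF orth]) auto
  have "card ?B = 3" using ne by simp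
  then have "UNIV \<subseteq> span ?B"
    using ind by (intro card_ge_dim_independent) auto
  then have "w \<in> span ?B" by auto
  then have "(\<Sum>i\<in>?B. (w \<bullet> i) *\<^sub>R i) = w"
    using fr by (intro orthonormal_basis_expand orth) (auto simp: is_frame_def)
  then show ?thesis using ne by (simp add: add.assoc)
qed

lemma frame_norm:
  assumes fr: "is_frame n u v"
  shows "w \<bullet> w = (w \<bullet> n)\<^sup>2 + (w \<bullet> u)\<^sup>2 + (w \<bullet> v)\<^sup>2"
proof -
  have "w \<bullet> w = w \<bullet> ((w \<bullet> n) *\<^sub>R n + (w \<bullet> u) *\<^sub>R u + (w \<bullet> v) *\<^sub>R v)"
    using frame_expand[OF fr, of w] by simp
  then show ?thesis by (simp add: inner_add_right power2_eq_square)
qed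

text \<open>The cross product of \<open>u\<close> and \<open>v\<close> is orthogonal to both and has
  length 1, so it is \<open>n\<close> up to sign. Its third component is the Jacobian of the
  vertical projection restricted to the plane spanned by \<open>u\<close> and
  \<open>v\<close>.\<close>

lemma frame_cross_component:
  assumes fr: "is_frame n u v"
  shows "\<bar>u $ 1 * v $ 2 - v $ 1 * u $ 2\<bar> = \<bar>n $ 3\<bar>"
proof -
  note i = is_frame_inner[OF fr]
  define w where "w = cross3 u v"
  have w0: "w \<bullet> u = 0" "w \<bullet> v = 0"
    by (simp_all add: w_def dot_cross_self inner_commute)
  have wn: "w = (w \<bullet> n) *\<^sub>R n" using frame_expand[OF fr, of w] w0 by simp
  have "(norm w)\<^sup>2 = 1" using norm_cross_dot[of u v] fr by (simp add: w_def is_frame_def)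
  then have "(w \<bullet> n)\<^sup>2 = 1" using frame_norm[OF fr, of w] w0 by (simp add: power2_norm_eq_inner)
  then have "\<bar>w \<bullet> n\<bar> = 1" by (auto simp: power2_eq_1_iff)
  moreover have "w $ 3 = (w \<bullet> n) * n $ 3" using arg_cong[OF wn, of "\<lambda>x. x $ 3"] by simp
  ultimately have "\<bar>w $ 3\<bar> = \<bar>n $ 3\<bar>" by (simp add: abs_mult)
  then show ?thesis by (simp add: w_def cross_components)
qed

text \<open>At fixed height this is the parametrisation used by \<open>circle_int\<close> for the
  circle in \<open>Mf\<close> with axis \<open>n\<close>.\<close>

definition sph :: "real^3 \<Rightarrow> real^3 \<Rightarrow> real^3 \<Rightarrow> real \<times> real \<Rightarrow> real^3" where
  "sph n u v z = fst z *\<^sub>R n + (sqrt (1 - (fst z)\<^sup>2) * cos (snd z)) *\<^sub>R u + (sqrt (1 - (fst z)\<^sup>2) * sin (snd z)) *\<^sub>R v"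

lemma continuous_on_sph: "continuous_on S (sph n u v)"
  unfolding sph_def by (intro continuous_intros)

lemma sph_inner:
  assumes fr: "is_frame n u v"
  shows "sph n u v z \<bullet> n = fst z" "n \<bullet> sph n u v z = fst z"
    "sph n u v z \<bullet> u = sqrt (1 - (fst z)\<^sup>2) * cos (snd z)"
    "sph n u v z \<bullet> v = sqrt (1 - (fst z)\<^sup>2) * sin (snd z)"
  by (simp_all add: sph_def inner_add_left inner_add_right is_frame_inner[OF fr])

lemma norm_sph:
  assumes fr: "is_frame n u v" and "\<bar>fst z\<bar> \<le> 1"
  shows "norm (sph n u v z) = 1"
proof -
  have "(fst z)\<^sup>2 \<le> 1" using assms(2) by (simp add: abs_square_le_1)
  then have "sph n u v z \<bullet> sph n u v z = (fst z)\<^sup>2 + (1 - (fst z)\<^sup>2) * ((cos (snd z))\<^sup>2 + (sin (snd z))\<^sup>2)"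
    unfolding frame_norm[OF fr, of "sph n u v z"] sph_inner[OF fr]
    by (simp add: power_mult_distrib algebra_simps del: sin_cos_squared_add sin_cos_squared_add2)
  then show ?thesis by (simp add: norm_eq_1)
qed

section \<open>The hemisphere as a graph, and surface measure pulled back from the disc\<close>

lemma lift_nth: "lift p $ 1 = p $ 1" "lift p $ 2 = p $ 2" "lift p $ 3 = sqrt (1 - ((p$1)\<^sup>2 + (p$2)\<^sup>2))"
  by (simp_all add: lift_def)

lemma lift_proj:
  assumes "norm x = 1" "x $ 3 \<ge> 0" "p $ 1 = x $ 1" "p $ 2 = x $ 2"
  shows "lift p = x"
proof -
  have "x \<bullet> x = 1" using assms(1) by (simp add: norm_eq_1)
  then have "(x$3)\<^sup>2 = 1 - ((x$1)\<^sup>2 + (x$2)\<^sup>2)" by (simp add: inner_vec_def sum_3 power2_eq_square)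
  then have "x $ 3 = sqrt (1 - ((x$1)\<^sup>2 + (x$2)\<^sup>2))" using assms(2) by (metis real_sqrt_unique)
  then show ?thesis using assms(3,4) by (simp add: vec_eq_iff forall_3 lift_nth)
qed

lemma norm_lift:
  assumes "(p$1)\<^sup>2 + (p$2)\<^sup>2 \<le> 1" shows "norm (lift p) = 1"
  using assms by (simp add: norm_eq_1 inner_vec_def sum_3 lift_nth power2_eq_square[symmetric])

lemma continuous_on_lift_vec2: "continuous_on S (\<lambda>y. lift (vec2 y))"
proof -
  have "continuous_on S (\<lambda>y. lift (vec2 y) $ i)" for i
  proof -
    consider "i = 1" | "i = 2" | "i = 3" using exhaust_3 by blast
    then show ?thesis by cases (simp_all only: lift_nth vec2_nth, (intro continuous_intros)+)
  qed
  then show ?thesis by (subst continuous_on_componentwise)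
      (auto simp: Basis_vec_def inner_axis)
qed

lemma sets_sph_domain:
  "{z. -1 < fst z \<and> fst z < 1 \<and> 0 \<le> snd z \<and> snd z < 2*pi \<and> sph n u v z $ 3 > c} \<in> sets borel" (is "?S \<in> _")
proof -
  have c3: "continuous_on UNIV (\<lambda>z. sph n u v z $ 3)"
    by (intro continuous_on_component continuous_on_sph)
  have "?S = {z. -1 < fst z} \<inter> {z. fst z < 1} \<inter> {z. 0 \<le> snd z} \<inter> {z. snd z < 2*pi} \<inter> {z. c < sph n u v z $ 3}"
    by auto
  moreover have "{z :: real \<times> real. -1 < fst z} \<in> sets borel" "{z :: real \<times> real. fst z < 1} \<in> sets borel"
    "{z :: real \<times> real. snd z < 2*pi} \<in> sets borel" "{z. c < sph n u v z $ 3} \<in> sets borel"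
    by (intro borel_open open_Collect_less continuous_intros c3)+
  moreover have "{z :: real \<times> real. 0 \<le> snd z} \<in> sets borel"
    by (intro borel_closed closed_Collect_le continuous_intros)
  ultimately show ?thesis by (auto intro!: sets.Int)
qed

text \<open>Height and longitude preserve area, because the coordinate vectors have reciprocal
  lengths and are orthogonal. Projecting the tangent plane vertically multiplies area by the third
  coordinate, and this is the only Jacobian left. The axis \<open>n\<close> has height
  \<open>cos \<theta>\<close>, so both poles of the coordinates stay outside the open cap.\<close>

lemma sph_change_of_variables:
  fixes h :: "real^3 \<Rightarrow> real"
  assumes fr: "is_frame n u v" and \<theta>: "0 < \<theta>" "\<theta> \<le> pi / 2" and n3: "n $ 3 = cos \<theta>"
    and h [measurable]: "h \<in> borel_measurable borel"
  defines "S \<equiv> {z. -1 < fst z \<and> fst z < 1 \<and> 0 \<le> snd z \<and> snd z < 2*pi \<and> sph n u v z $ 3 > cos \<theta>}"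
  shows "integrable lborel (\<lambda>z. indicator S z * h (sph n u v z)) \<longleftrightarrow>
      integrable lborel (\<lambda>y. indicator (ball 0 (sin \<theta>)) y * (h (lift (vec2 y)) / lift (vec2 y) $ 3))"
    and "(\<integral>z. indicator S z * h (sph n u v z) \<partial>lborel) =
      (\<integral>y. indicator (ball 0 (sin \<theta>)) y * (h (lift (vec2 y)) / lift (vec2 y) $ 3) \<partial>lborel)"
proof -
  define E where "E = sph n u v"
  define g where "g z = (E z $ 1, E z $ 2)" for z
  note i = is_frame_inner[OF fr]
  have cos0: "0 \<le> cos \<theta>" using \<theta> by (intro cos_ge_zero) auto
  have sin0: "0 < sin \<theta>" using \<theta> by (intro sin_gt_zero) auto
  have Em [measurable]: "E \<in> borel_measurable borel"
    unfolding E_def by (intro borel_measurable_continuous_onI continuous_on_sph)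
  have S [measurable]: "S \<in> sets borel" unfolding S_def by (rule sets_sph_domain)
  have nE: "norm (E z) = 1" if "z \<in> S" for z using that norm_sph[OF fr, of z] by (auto simp: E_def S_def)
  have lg: "lift (vec2 (g z)) = E z" if "z \<in> S" for z
    using that nE[OF that] cos0 by (intro lift_proj) (auto simp: S_def E_def g_def)
  have E3: "E z $ 3 > 0" if "z \<in> S" for z using that cos0 by (auto simp: S_def E_def)
  have inj: "inj_on g S"
  proof (rule inj_onI)
    fix z w assume zw: "z \<in> S" "w \<in> S" "g z = g w"
    then have EE: "E z = E w" using lg[OF zw(1)] lg[OF zw(2)] by simp
    then have f: "fst z = fst w" using sph_inner(1)[OF fr, of z] sph_inner(1)[OF fr, of w] by (simp add: E_def)
    have "(fst w)\<^sup>2 < 1" using zw(2) by (auto simp: S_def abs_square_less_1)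
    then have "sqrt (1 - (fst w)\<^sup>2) \<noteq> 0" by simp
    moreover have "sqrt (1 - (fst w)\<^sup>2) * cos (snd z) = sqrt (1 - (fst w)\<^sup>2) * cos (snd w)"
      "sqrt (1 - (fst w)\<^sup>2) * sin (snd z) = sqrt (1 - (fst w)\<^sup>2) * sin (snd w)"
      using sph_inner(3,4)[OF fr, of z, folded E_def, unfolded EE f]
        sph_inner(3,4)[OF fr, of w, folded E_def] by (simp_all only:)
    ultimately have "cos (snd z) = cos (snd w)" "sin (snd z) = sin (snd w)"
      by (simp_all only: mult_cancel_left simp_thms)
    moreover have "0 \<le> snd z" "snd z < 2*pi" "0 \<le> snd w" "snd w < 2*pi"
      using zw(1,2) by (simp_all add: S_def)
    ultimately have "snd z = snd w" by (blast intro: sin_cos_inj_on_2pi)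
    with f show "z = w" by (simp add: prod_eq_iff)
  qed
  have img: "g ` S = ball 0 (sin \<theta>)"
  proof (intro equalityI subsetI)
    fix y assume "y \<in> g ` S"
    then obtain z where z: "z \<in> S" "y = g z" by auto
    have "(E z $ 1)\<^sup>2 + (E z $ 2)\<^sup>2 + (E z $ 3)\<^sup>2 = 1"
      using nE[OF z(1)] by (simp add: norm_eq_1 inner_vec_def sum_3 power2_eq_square)
    moreover have "(cos \<theta>)\<^sup>2 < (E z $ 3)\<^sup>2" using z(1) cos0 by (intro power_strict_mono) (auto simp: S_def E_def)
    moreover have "(cos \<theta>)\<^sup>2 = 1 - (sin \<theta>)\<^sup>2" by (rule cos_squared_eq)
    ultimately have "(E z $ 1)\<^sup>2 + (E z $ 2)\<^sup>2 < (sin \<theta>)\<^sup>2" by linarith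
    then have "sqrt ((E z $ 1)\<^sup>2 + (E z $ 2)\<^sup>2) < sin \<theta>" using sin0 by (simp add: real_less_lsqrt)
    then show "y \<in> ball 0 (sin \<theta>)" using z(2) by (simp add: g_def norm_Pair)
  next
    fix y :: "real \<times> real" assume "y \<in> ball 0 (sin \<theta>)"
    then have "norm y < sin \<theta>" by simp
    then have "(norm y)\<^sup>2 < (sin \<theta>)\<^sup>2" by (intro power_strict_mono) auto
    then have y: "(fst y)\<^sup>2 + (snd y)\<^sup>2 < (sin \<theta>)\<^sup>2" by (cases y) (simp add: norm_Pair)
    define w where "w = lift (vec2 y)"
    have "(sin \<theta>)\<^sup>2 \<le> 1" by (simp add: abs_square_le_1)
    then have nw: "norm w = 1" unfolding w_def using y by (intro norm_lift) simp
    have w3: "w $ 3 > cos \<theta>"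
    proof -
      have "(cos \<theta>)\<^sup>2 < 1 - ((fst y)\<^sup>2 + (snd y)\<^sup>2)" using y by (simp add: cos_squared_eq)
      then show ?thesis using cos0 by (simp add: w_def lift_nth real_less_rsqrt)
    qed
    define t where "t = w \<bullet> n"
    have tw: "t\<^sup>2 + (w \<bullet> u)\<^sup>2 + (w \<bullet> v)\<^sup>2 = 1" using frame_norm[OF fr, of w] nw by (simp add: t_def norm_eq_1)
    \<comment> \<open>The point \<open>w\<close> is not a pole: \<open>n\<close> and
      \<open>- n\<close> have third coordinates \<open>cos \<theta>\<close> and
      \<open>- cos \<theta>\<close>, both too small for the cap. Hence its longitude is
      defined.\<close>
    have "(w \<bullet> u)\<^sup>2 + (w \<bullet> v)\<^sup>2 \<noteq> 0"
    proof
      assume "(w \<bullet> u)\<^sup>2 + (w \<bullet> v)\<^sup>2 = 0"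
      then have 0: "w \<bullet> u = 0" "w \<bullet> v = 0" by (simp_all add: sum_power2_eq_zero_iff)
      then have "t\<^sup>2 = 1" using tw by simp
      then have "t = 1 \<or> t = -1" by (simp add: power2_eq_1_iff)
      moreover have "w = t *\<^sub>R n" using frame_expand[OF fr, of w] 0 by (simp add: t_def)
      ultimately have "w $ 3 = cos \<theta> \<or> w $ 3 = - cos \<theta>" using n3 by auto
      then show False using w3 cos0 by auto
    qed
    then have "0 < (w \<bullet> u)\<^sup>2 + (w \<bullet> v)\<^sup>2" by (simp add: less_le)
    then have t1: "t\<^sup>2 < 1" using tw by linarith
    define s where "s = sqrt (1 - t\<^sup>2)"
    have s: "s > 0" "s\<^sup>2 = 1 - t\<^sup>2" using t1 by (simp_all add: s_def)
    have "(w \<bullet> u / s)\<^sup>2 + (w \<bullet> v / s)\<^sup>2 = ((w \<bullet> u)\<^sup>2 + (w \<bullet> v)\<^sup>2) / s\<^sup>2"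
      by (simp add: power_divide add_divide_distrib)
    also have "(w \<bullet> u)\<^sup>2 + (w \<bullet> v)\<^sup>2 = s\<^sup>2" using tw s(2) by linarith
    finally have "(w \<bullet> u / s)\<^sup>2 + (w \<bullet> v / s)\<^sup>2 = 1" using s(1) by simp
    then obtain \<phi> where \<phi>: "0 \<le> \<phi>" "\<phi> < 2*pi" "w \<bullet> u / s = cos \<phi>" "w \<bullet> v / s = sin \<phi>"
      using sincos_total_2pi by metis
    have wE: "w = E (t, \<phi>)"
    proof -
      have "w \<bullet> u = s * cos \<phi>" "w \<bullet> v = s * sin \<phi>" using \<phi>(3,4) s(1) by (simp_all add: field_simps)
      then show ?thesis using frame_expand[OF fr, of w] by (simp add: E_def sph_def t_def[symmetric] s_def)
    qed
    have "(t, \<phi>) \<in> S" using t1 \<phi> w3 wE by (auto simp: S_def E_def abs_square_less_1 abs_less_iff)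
    moreover have "y = g (t, \<phi>)" unfolding g_def wE[symmetric] by (simp add: w_def lift_nth)
    ultimately show "y \<in> g ` S" by blast
  qed
  define s where "s z = sqrt (1 - (fst z)\<^sup>2)" for z :: "real \<times> real"
  \<comment> \<open>The partial derivatives of the \<open>j\<close>-th coordinate of
    \<open>sph\<close>: \<open>a\<close> in the height, \<open>b\<close> in the longitude.\<close>
  define a where "a z j = n $ j - (fst z / s z) * (cos (snd z) * u $ j + sin (snd z) * v $ j)" for z j
  define b where "b z j = s z * (- sin (snd z) * u $ j + cos (snd z) * v $ j)" for z j
  have der: "(g has_derivative (\<lambda>k. (a z 1 * fst k + b z 1 * snd k, a z 2 * fst k + b z 2 * snd k))) (at z)" if "z \<in> S" for z
  proof -
    have "(fst z)\<^sup>2 < 1" using that by (auto simp: S_def abs_square_less_1)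
    then have pos: "0 < 1 - (fst z)\<^sup>2" by simp
    then have "s z \<noteq> 0" by (simp add: s_def)
    have sd: "(s has_derivative (\<lambda>k. - (fst z / s z) * fst k)) (at z)"
      unfolding s_def using pos by (auto intro!: derivative_eq_intros simp: field_simps)
    have "((\<lambda>z. E z $ j) has_derivative (\<lambda>k. a z j * fst k + b z j * snd k)) (at z)" for j
      unfolding E_def sph_def s_def[symmetric] vector_add_component vector_scaleR_component
      by (rule derivative_eq_intros sd refl)+ (simp add: fun_eq_iff a_def b_def algebra_simps)
    then show ?thesis unfolding g_def by (intro has_derivative_Pair)
  qed
  have det: "\<bar>a z 1 * b z 2 - b z 1 * a z 2\<bar> = E z $ 3" if "z \<in> S" for z
  proof -
    have "(fst z)\<^sup>2 < 1" using that by (auto simp: S_def abs_square_less_1)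
    then have s2: "s z > 0" "(s z)\<^sup>2 = 1 - (fst z)\<^sup>2" by (simp_all add: s_def)
    define c d where "c = cos (snd z)" and "d = sin (snd z)"
    \<comment> \<open>\<open>p\<close> is the height derivative times \<open>s z\<close>, and
      \<open>q\<close> is the longitude derivative divided by \<open>s z\<close>. The reciprocal
      factors leave the determinant unchanged and turn the coordinate vectors into an orthonormal
      frame with normal \<open>E z\<close>.\<close>
    define p where "p = s z *\<^sub>R n - (fst z * c) *\<^sub>R u - (fst z * d) *\<^sub>R v"
    define q where "q = (- d) *\<^sub>R u + c *\<^sub>R v"
    have cs: "c\<^sup>2 + d\<^sup>2 = 1" by (simp add: c_def d_def)
    have Ez: "E z = fst z *\<^sub>R n + (s z * c) *\<^sub>R u + (s z * d) *\<^sub>R v"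
      by (simp add: E_def sph_def s_def c_def d_def)
    have "p \<bullet> p = (s z)\<^sup>2 + (fst z)\<^sup>2 * (c\<^sup>2 + d\<^sup>2)"
      by (simp add: p_def inner_add_left inner_add_right inner_diff_left inner_diff_right i power2_eq_square algebra_simps)
    then have 1: "p \<bullet> p = 1" using s2 cs by simp
    have 2: "q \<bullet> q = 1" using cs
      by (simp add: q_def inner_add_left inner_add_right inner_diff_left inner_diff_right i power2_eq_square algebra_simps)
    have 3: "p \<bullet> q = 0"
      by (simp add: p_def q_def inner_add_left inner_add_right inner_diff_left inner_diff_right i algebra_simps)
    have "p \<bullet> E z = s z * fst z - fst z * s z * (c\<^sup>2 + d\<^sup>2)"
      unfolding Ez by (simp add: p_def inner_add_left inner_add_right inner_diff_left inner_diff_right i power2_eq_square algebra_simps)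
    then have 4: "p \<bullet> E z = 0" using cs by simp
    have 5: "q \<bullet> E z = 0"
      unfolding Ez by (simp add: q_def inner_add_left inner_add_right inner_diff_left inner_diff_right i algebra_simps)
    have "is_frame (E z) p q" using 1 2 3 4 5 nE[OF that] by (simp add: is_frame_def norm_eq_1)
    from frame_cross_component[OF this]
    have "\<bar>p $ 1 * q $ 2 - q $ 1 * p $ 2\<bar> = E z $ 3" using E3[OF that] by simp
    moreover have "p $ j = s z * a z j" "b z j = s z * q $ j" for j
      using s2(1) by (simp_all add: p_def q_def a_def b_def c_def d_def field_simps)
    ultimately show ?thesis by (simp add: algebra_simps)
  qed
  define f where "f y = h (lift (vec2 y)) / lift (vec2 y) $ 3" for y
  have lm [measurable]: "(\<lambda>y. lift (vec2 y)) \<in> borel_measurable borel"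
    by (intro borel_measurable_continuous_onI continuous_on_lift_vec2)
  have lm3: "(\<lambda>y. lift (vec2 y) $ 3) \<in> borel_measurable borel"
    by (intro borel_measurable_continuous_onI continuous_on_component continuous_on_lift_vec2)
  have fm: "f \<in> borel_measurable borel"
    unfolding f_def using measurable_compose[OF lm h] lm3 by (rule borel_measurable_divide)
  have eq: "indicator S z * (\<bar>a z 1 * b z 2 - b z 1 * a z 2\<bar> * f (g z)) = indicator S z * h (E z)" for z
    using det lg E3[of z] by (cases "z \<in> S") (auto simp: f_def)
  have m1: "(\<lambda>z. indicator S z * (\<bar>a z 1 * b z 2 - b z 1 * a z 2\<bar> * f (g z))) \<in> borel_measurable borel"
    unfolding eq using measurable_compose[OF Em h]
    by (intro borel_measurable_times borel_measurable_indicator S)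
  have m2: "(\<lambda>y. indicator (g ` S) y * f y) \<in> borel_measurable borel"
    unfolding img by (intro borel_measurable_times borel_measurable_indicator fm) simp
  have gS: "g ` S \<in> sets borel" unfolding img by simp
  note cv = change_of_variables_plane[OF S gS der inj m1 m2, unfolded eq img, unfolded f_def]
  show "integrable lborel (\<lambda>z. indicator S z * h (sph n u v z)) \<longleftrightarrow>
      integrable lborel (\<lambda>y. indicator (ball 0 (sin \<theta>)) y * (h (lift (vec2 y)) / lift (vec2 y) $ 3))"
    using cv(1) by (simp add: E_def)
  show "(\<integral>z. indicator S z * h (sph n u v z) \<partial>lborel) =
      (\<integral>y. indicator (ball 0 (sin \<theta>)) y * (h (lift (vec2 y)) / lift (vec2 y) $ 3) \<partial>lborel)"
    using cv(2) by (simp add: E_def)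
qed

section \<open>The circular means integrated against the logarithm\<close>

lemma norm_sq_plane: "(norm y)\<^sup>2 = (fst y)\<^sup>2 + (snd y)\<^sup>2" for y :: "real \<times> real"
  by (cases y) (simp add: norm_Pair)

lemma norm_lift_vec2: "norm y \<le> 1 \<Longrightarrow> norm (lift (vec2 y)) = 1"
  using norm_sq_plane[of y] power_le_one[of "norm y" 2] by (intro norm_lift) simp

lemma powr_neg_half: "0 < a \<Longrightarrow> a powr (-1/2) = 1 / sqrt a" for a :: real
proof -
  assume a: "0 < a"
  have "-1/2 = - (1/2::real)" by simp
  then have "a powr (-1/2) = inverse (a powr (1/2))" by (simp only: powr_minus)
  also have "a powr (1/2) = sqrt a" using a by (intro powr_half_sqrt) simp
  finally show ?thesis by (simp only: inverse_eq_divide)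
qed

lemma borel_measurable_restrict_sphere:
  fixes f :: "real^3 \<Rightarrow> real"
  assumes "continuous_on (sphere 0 1) f"
  shows "(\<lambda>y. indicator (sphere 0 1) y * f y) \<in> borel_measurable borel"
  using borel_measurable_continuous_on_indicator[of "sphere 0 1" f] assms by simp

lemma AE_fst_neq: "AE z in lborel. fst (z :: real \<times> real) \<noteq> c"
  using AE_lborel_inner_neq[of "(1, 0) :: real \<times> real" c] by (simp add: Basis_prod_def inner_prod_def)

text \<open>The weight in \<open>Mf\<close> cancels the radius in the arc length, so up to
  \<open>2 * pi\<close> the transform is a plain integral over longitude. Fubini in height and
  longitude followed by projection to the disc gives the right-hand side; the singular factor
  depends on the height alone, which makes the double integral absolutely convergent.\<close>

lemma mean_ln_integral:
  fixes f :: "real^3 \<Rightarrow> real"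
  assumes \<theta>: "0 < \<theta>" "\<theta> \<le> pi / 2" and n: "norm n = 1" "n $ 3 = cos \<theta>"
    and f: "continuous_on (sphere 0 1) f" and supp: "\<And>y. norm y = 1 \<Longrightarrow> y $ 3 \<le> cos \<theta> \<Longrightarrow> f y = 0"
  shows "integrable lborel (\<lambda>y. indicator (ball 0 (sin \<theta>)) y *
          (f (lift (vec2 y)) / lift (vec2 y) $ 3 * ln \<bar>n \<bullet> lift (vec2 y) - t\<bar>))" (is "integrable _ ?R")
    and "2 * pi * integral {-1..1} (\<lambda>\<tau>. Mf f n \<tau> * ln \<bar>\<tau> - t\<bar>) =
          (\<integral>y. indicator (ball 0 (sin \<theta>)) y *
          (f (lift (vec2 y)) / lift (vec2 y) $ 3 * ln \<bar>n \<bullet> lift (vec2 y) - t\<bar>) \<partial>lborel)"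
proof -
  obtain u v where fr: "is_frame n u v" and circ: "\<forall>g c r. circle_int g c n r =
      integral {0..2*pi} (\<lambda>\<phi>. g (c + (r * cos \<phi>) *\<^sub>R u + (r * sin \<phi>) *\<^sub>R v) * r)"
    using circle_int_frame[OF n(1)] by blast
  define E where "E = sph n u v"
  let ?B = "{-1..1} \<times> {0..2*pi} :: (real \<times> real) set"
  define I where "I z = indicator ?B z * (f (E z) * ln \<bar>fst z - t\<bar>)" for z
  have nE: "norm (E z) = 1" if "\<bar>fst z\<bar> \<le> 1" for z using norm_sph[OF fr that] by (simp add: E_def)
  have fE: "continuous_on ?B (\<lambda>z. f (E z))"
    unfolding E_def by (rule continuous_on_compose2[OF f continuous_on_sph]) (auto simp: norm_sph[OF fr] abs_le_iff)
  have Ii: "integrable lborel I"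
    unfolding I_def by (rule integrable_times_fst[OF fE integrable_indicator_ln_abs])
  define S where "S = {z. -1 < fst z \<and> fst z < 1 \<and> 0 \<le> snd z \<and> snd z < 2*pi \<and> sph n u v z $ 3 > cos \<theta>}"
  \<comment> \<open>Continuity of \<open>f\<close> is known on the sphere only; the indicator of the
    sphere makes the integrand Borel on the whole space.\<close>
  define h where "h y = indicator (sphere 0 1) y * f y * ln \<bar>n \<bullet> y - t\<bar>" for y
  have hm: "h \<in> borel_measurable borel"
    unfolding h_def by (intro borel_measurable_times borel_measurable_restrict_sphere f borel_measurable_ln
        borel_measurable_continuous_onI continuous_intros)
  note cv = sph_change_of_variables[OF fr \<theta> n(2) hm, folded S_def]
  \<comment> \<open>Passing from the full rectangle to \<open>S\<close> removes points where
    \<open>f\<close> vanishes and the edges of the rectangle, which are null.\<close>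
  have ae: "AE z in lborel. I z = indicator S z * h (sph n u v z)"
    using AE_fst_neq[of "-1"] AE_fst_neq[of 1] AE_snd_neq[of "2*pi"]
  proof eventually_elim
    case (elim z)
    show ?case
    proof (cases "z \<in> ?B")
      case True
      then have z: "-1 \<le> fst z" "fst z \<le> 1" "0 \<le> snd z" "snd z \<le> 2*pi" by (simp_all add: mem_Times_iff)
      then have nz: "norm (sph n u v z) = 1" using nE[of z] by (simp add: E_def)
      show ?thesis
      proof (cases "sph n u v z $ 3 > cos \<theta>")
        case 3: True
        then have "z \<in> S" using z elim by (simp add: S_def)
        then show ?thesis using True nz by (simp add: I_def E_def h_def sph_inner[OF fr])
      next
        case False
        then have "f (sph n u v z) = 0" using supp[OF nz] by simp
        then show ?thesis by (simp add: I_def E_def h_def)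
      qed
    next
      case False
      then have "z \<notin> S" by (auto simp: S_def mem_Times_iff)
      then show ?thesis using False by (simp add: I_def)
    qed
  qed
  have Req: "indicator (ball 0 (sin \<theta>)) y * (h (lift (vec2 y)) / lift (vec2 y) $ 3) = ?R y" for y
  proof (cases "y \<in> ball 0 (sin \<theta>)")
    case True
    then have "norm y \<le> 1" using sin_le_one[of \<theta>] by (simp del: sin_le_one)
    then have "norm (lift (vec2 y)) = 1" by (rule norm_lift_vec2)
    then show ?thesis using True by (simp add: h_def)
  qed simp
  have Im: "I \<in> borel_measurable lborel" using Ii by auto
  have hSm: "(\<lambda>z. indicator S z * h (sph n u v z)) \<in> borel_measurable lborel"
  proof -
    have "S \<in> sets borel" unfolding S_def by (rule sets_sph_domain)
    moreover have "(\<lambda>z. h (sph n u v z)) \<in> borel_measurable borel"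
      by (rule measurable_compose[OF borel_measurable_continuous_onI[OF continuous_on_sph] hm])
    ultimately show ?thesis by (auto intro: borel_measurable_times borel_measurable_indicator)
  qed
  have "integrable lborel (\<lambda>z. indicator S z * h (sph n u v z))"
    using integrable_cong_AE[OF Im hSm ae] Ii by simp
  then show "integrable lborel ?R" using cv(1) unfolding Req by simp
  have IR: "integral\<^sup>L lborel I = integral\<^sup>L lborel ?R"
    using integral_cong_AE[OF Im hSm ae] cv(2) unfolding Req by simp
  define m where "m \<tau> = (\<integral>\<phi>. indicator {0..2*pi} \<phi> * f (E (\<tau>, \<phi>)) \<partial>lborel)" for \<tau>
  have Isplit: "I (\<tau>, \<phi>) = (indicator {-1..1} \<tau> * ln \<bar>\<tau> - t\<bar>) * (indicator {0..2*pi} \<phi> * f (E (\<tau>, \<phi>)))" for \<tau> \<phi>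
    by (auto simp: I_def indicator_def)
  have Iphi: "(\<integral>\<phi>. I (\<tau>, \<phi>) \<partial>lborel) = indicator {-1..1} \<tau> * (m \<tau> * ln \<bar>\<tau> - t\<bar>)" for \<tau>
    unfolding Isplit m_def by simp
  have Ii': "integrable (lborel \<Otimes>\<^sub>M lborel) I" using Ii by (simp add: lborel_prod)
  have mi: "integrable lborel (\<lambda>\<tau>. indicator {-1..1} \<tau> * (m \<tau> * ln \<bar>\<tau> - t\<bar>))"
    using lborel_pair.integrable_fst'[OF Ii'] unfolding Iphi .
  have mv: "(\<integral>\<tau>. indicator {-1..1} \<tau> * (m \<tau> * ln \<bar>\<tau> - t\<bar>) \<partial>lborel) = integral\<^sup>L lborel I"
    using lborel_pair.integral_fst'[OF Ii'] unfolding Iphi by (simp add: lborel_prod)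
  have "set_integrable lborel {-1..1} (\<lambda>\<tau>. m \<tau> * ln \<bar>\<tau> - t\<bar>)"
    unfolding set_integrable_def using mi by simp
  from set_borel_integral_eq_integral(2)[OF this]
  have mHK: "integral {-1..1} (\<lambda>\<tau>. m \<tau> * ln \<bar>\<tau> - t\<bar>) = integral\<^sup>L lborel I"
    unfolding set_lebesgue_integral_def using mv by simp
  have Mm: "2 * pi * Mf f n \<tau> = m \<tau>" if "-1 < \<tau>" "\<tau> < 1" for \<tau>
  proof -
    have t2: "0 < 1 - \<tau>\<^sup>2" using that by (simp add: abs_square_less_1 abs_less_iff)
    define r where "r = sqrt (1 - \<tau>\<^sup>2)"
    have r: "r > 0" using t2 by (simp add: r_def)
    have pw: "(1 - \<tau>\<^sup>2) powr (-1/2) = 1 / r"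
      unfolding r_def by (rule powr_neg_half[OF t2])
    have cont: "continuous_on {0..2*pi} (\<lambda>\<phi>. f (E (\<tau>, \<phi>)))"
    proof (rule continuous_on_compose2[OF fE])
      show "continuous_on {0..2*pi} (\<lambda>\<phi>. (\<tau>, \<phi>))" by (intro continuous_intros)
    qed (use that in auto)
    have "circle_int f (\<tau> *\<^sub>R n) n r = integral {0..2*pi} (\<lambda>\<phi>. f (E (\<tau>, \<phi>)) * r)"
      unfolding circ[rule_format] by (simp add: E_def sph_def r_def)
    also have "\<dots> = integral {0..2*pi} (\<lambda>\<phi>. f (E (\<tau>, \<phi>))) * r" by simp
    also have "integral {0..2*pi} (\<lambda>\<phi>. f (E (\<tau>, \<phi>))) = m \<tau>"
    proof -
      have "set_integrable lborel {0..2*pi} (\<lambda>\<phi>. f (E (\<tau>, \<phi>)))"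
        unfolding set_integrable_def by (rule borel_integrable_compact) (use cont in auto)
      from set_borel_integral_eq_integral(2)[OF this] show ?thesis
        by (simp add: set_lebesgue_integral_def m_def)
    qed
    finally show ?thesis unfolding Mf_def pw r_def[symmetric] using r by simp
  qed
  have "2 * pi * integral {-1..1} (\<lambda>\<tau>. Mf f n \<tau> * ln \<bar>\<tau> - t\<bar>) =
      integral {-1..1} (\<lambda>\<tau>. 2 * pi * (Mf f n \<tau> * ln \<bar>\<tau> - t\<bar>))" by simp
  also have "\<dots> = integral {-1..1} (\<lambda>\<tau>. m \<tau> * ln \<bar>\<tau> - t\<bar>)"
  \<comment> \<open>At the two end heights the circle shrinks to a point and its radius cannot be
    cancelled; two points do not affect the integral.\<close>
  proof (rule integral_spike[of "{-1, 1}"])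
    fix \<tau> :: real assume "\<tau> \<in> {-1..1} - {-1, 1}"
    then have "2 * pi * Mf f n \<tau> = m \<tau>" by (intro Mm) auto
    then show "m \<tau> * ln \<bar>\<tau> - t\<bar> = 2 * pi * (Mf f n \<tau> * ln \<bar>\<tau> - t\<bar>)" by (simp add: mult.assoc[symmetric])
  qed auto
  finally show "2 * pi * integral {-1..1} (\<lambda>\<tau>. Mf f n \<tau> * ln \<bar>\<tau> - t\<bar>) = integral\<^sup>L lborel ?R"
    using mHK IR by simp
qed

section \<open>The inversion formula\<close>

text \<open>The Laplacian is local, so an identity on a neighbourhood of \<open>p\<close> suffices.
  The backprojection equals an affine function of the potential only over the disc below the
  cap.\<close>

lemma has_laplacian_affine_transform:
  assumes "open A" "p \<in> A" and G: "\<And>q. q \<in> A \<Longrightarrow> G q = c * N q + d" and N: "has_laplacian N p L"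
  shows "has_laplacian G p (c * L)"
proof -
  obtain D where D: "\<And>i. second_partial N p i (D i)" and L: "L = (\<Sum>i\<in>UNIV. D i)"
    using N unfolding has_laplacian_def by blast
  have "second_partial G p i (c * D i)" for i
  proof -
    obtain g where g: "\<forall>\<^sub>F s in nhds 0. ((\<lambda>u. N (p + u *\<^sub>R axis i 1)) has_real_derivative g s) (at s)"
      and g0: "(g has_real_derivative D i) (at 0)"
      using D[of i] unfolding second_partial_def by blast
    define T where "T = {s. p + s *\<^sub>R axis i 1 \<in> A}"
    have "T = (\<lambda>s. p + s *\<^sub>R axis i 1) -` A" by (auto simp: T_def)
    then have T: "open T"
      using assms(1) by (simp add: open_vimage continuous_intros)
    have "\<forall>\<^sub>F s in nhds 0. s \<in> T"
      using T assms(2) by (intro eventually_nhds_in_open) (simp_all add: T_def)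
    with g have "\<forall>\<^sub>F s in nhds 0. ((\<lambda>u. G (p + u *\<^sub>R axis i 1)) has_real_derivative c * g s) (at s)"
    proof eventually_elim
      case (elim s)
      have "((\<lambda>u. c * N (p + u *\<^sub>R axis i 1) + d) has_real_derivative c * g s) (at s)"
        using DERIV_cmult[OF elim(1), of c] by (auto intro: DERIV_add[where E=0, simplified])
      then show ?case
        by (rule has_field_derivative_transform_within_open[OF _ T elim(2)]) (simp add: T_def G)
    qed
    moreover have "((\<lambda>s. c * g s) has_real_derivative c * D i) (at 0)" by (rule DERIV_cmult[OF g0])
    ultimately show ?thesis unfolding second_partial_def by (intro exI[of _ "\<lambda>s. c * g s"] conjI)
  qed
  then show ?thesis unfolding has_laplacian_def L
    by (intro exI[of _ "\<lambda>i. c * D i"]) (simp add: sum_distrib_left)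
qed

text \<open>The density of \<open>f\<close> times surface measure on the cap, in the coordinates \<open>x'\<close>.\<close>
definition cap_density :: "(real^3 \<Rightarrow> real) \<Rightarrow> real \<Rightarrow> real \<times> real \<Rightarrow> real" where
  "cap_density f \<theta> y = indicator (ball 0 (sin \<theta>)) y * (f (lift (vec2 y)) / lift (vec2 y) $ 3)"

lemma mem_cap_iff: "x \<in> cap \<theta> \<longleftrightarrow> norm x = 1 \<and> cos \<theta> < x $ 3"
  by (auto simp: cap_def e3_def inner_axis)

text \<open>Inside the open disc the density is built from smooth functions, the height there being
  positive. Off the projection \<open>P\<close> of the support it is zero. As \<open>P\<close> is a
  compact subset of the open disc, the two regions cover the plane. For
  \<open>\<theta> = pi / 2\<close> the height tends to 0 at the rim, and this margin keeps the
  quotient smooth there.\<close>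

lemma Cn_on_cap_density:
  assumes \<theta>: "0 < \<theta>" "\<theta> \<le> pi / 2" and f: "smooth_on_sphere f"
    and supp: "closure {y \<in> sphere 0 1. f y \<noteq> 0} \<subseteq> cap \<theta>"
  shows "Cn_on k UNIV (cap_density f \<theta>)"
proof -
  obtain U F where U: "open U" "sphere 0 1 \<subseteq> U" and F: "smooth_on U F" and Ff: "\<And>y. y \<in> sphere 0 1 \<Longrightarrow> F y = f y"
    using f unfolding smooth_on_sphere_def by (elim exE conjE) simp
  have cos0: "0 \<le> cos \<theta>" using \<theta> by (intro cos_ge_zero) auto
  have sin0: "0 < sin \<theta>" using \<theta> by (intro sin_gt_zero) auto
  let ?B = "ball 0 (sin \<theta>) :: (real \<times> real) set"
  define r where "r y = 1 - ((fst y)\<^sup>2 + (snd y)\<^sup>2)" for y :: "real \<times> real"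
  have nB: "norm y < 1" if "y \<in> ?B" for y using that sin_le_one[of \<theta>] by (simp del: sin_le_one)
  have rpos: "0 < r y" if "y \<in> ?B" for y
    using norm_sq_plane[of y] power_less_one_iff[of "norm y" 2] nB[OF that] by (simp add: r_def)
  have Cfst: "Cn_on k V fst" and Csnd: "Cn_on k V snd" for V :: "(real \<times> real) set"
    by (intro Cn_on_linear bounded_linear_fst bounded_linear_snd)+
  have Cr: "Cn_on k ?B r"
  proof -
    have "Cn_on k ?B (\<lambda>y. 1 + (-1) * (fst y * fst y + snd y * snd y))"
      by (intro Cn_on_add Cn_on_mult Cn_on_const Cfst Csnd)
    then show ?thesis by (rule Cn_on_cong[rotated]) (simp_all add: r_def power2_eq_square)
  qed
  have Cpow: "Cn_on k ?B (\<lambda>y. r y powr a)" for a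
    by (rule Cn_on_compose[OF Cn_on_powr]) (use rpos Cr in auto)
  have C3: "Cn_on k ?B (\<lambda>y. lift (vec2 y) $ 3)"
    by (rule Cn_on_cong[OF _ Cpow[of "1/2"]]) (use rpos in \<open>auto simp: lift_nth powr_half_sqrt less_imp_le r_def\<close>)
  \<comment> \<open>The smooth extension \<open>F\<close> replaces \<open>f\<close>, because
    composition needs derivatives in the ambient space; the two agree on the image of
    \<open>lift\<close>.\<close>
  have CF: "Cn_on k ?B (\<lambda>y. F (lift (vec2 y)))"
  proof (rule Cn_on_compose[where V=U])
    show "Cn_on k U F" using F by (simp add: smooth_on_def)
    show "(\<lambda>y. lift (vec2 y)) ` ?B \<subseteq> U"
    proof safe
      fix y assume "y \<in> ?B"
      then have "norm (lift (vec2 y)) = 1" using nB by (intro norm_lift_vec2) (simp add: less_imp_le)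
      then show "lift (vec2 y) \<in> U" using U(2) by auto
    qed
    fix b :: "real^3" assume "b \<in> Basis"
    then obtain i where b: "b = axis i 1" by (auto simp: Basis_vec_def)
    have "Cn_on k ?B (\<lambda>y. lift (vec2 y) $ i)"
    proof -
      consider "i = 1" | "i = 2" | "i = 3" using exhaust_3 by blast
      then show ?thesis by cases (simp_all only: lift_nth(1,2) vec2_nth Cfst Csnd C3)
    qed
    then show "Cn_on k ?B (\<lambda>y. lift (vec2 y) \<bullet> b)" by (simp add: b inner_axis)
  qed
  have onB: "Cn_on k ?B (cap_density f \<theta>)"
  proof (rule Cn_on_cong[OF _ Cn_on_mult[OF CF Cpow[of "-1/2"]]])
    fix y assume y: "y \<in> ?B"
    then have "norm (lift (vec2 y)) = 1" using nB by (intro norm_lift_vec2) (simp add: less_imp_le)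
    then have "F (lift (vec2 y)) = f (lift (vec2 y))" by (intro Ff) simp
    moreover have "r y powr (-1/2) = 1 / lift (vec2 y) $ 3"
      unfolding powr_neg_half[OF rpos[OF y]] by (simp add: lift_nth r_def)
    ultimately show "F (lift (vec2 y)) * r y powr (-1/2) = cap_density f \<theta> y"
      using y by (simp add: cap_density_def)
  qed simp
  define K where "K = closure {y \<in> sphere 0 1. f y \<noteq> 0}"
  define P where "P = (\<lambda>x :: real^3. (x $ 1, x $ 2)) ` K"
  have "bounded K" unfolding K_def by (rule bounded_closure, rule bounded_subset[OF bounded_sphere[of 0 1]]) auto
  then have "compact K" by (simp add: compact_eq_bounded_closed K_def)
  then have "compact P" unfolding P_def
    by (intro compact_continuous_image continuous_intros)
  then have Pc: "open (- P)" by (simp add: compact_imp_closed open_Compl)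
  have PB: "P \<subseteq> ?B"
  proof
    fix y assume "y \<in> P"
    then obtain x where x: "x \<in> K" "y = (x $ 1, x $ 2)" by (auto simp: P_def)
    then have "norm x = 1" "cos \<theta> < x $ 3" using supp mem_cap_iff by (auto simp: K_def)
    then have "(x$1)\<^sup>2 + (x$2)\<^sup>2 + (x$3)\<^sup>2 = 1" "(cos \<theta>)\<^sup>2 < (x$3)\<^sup>2"
      using cos0 by (simp_all add: norm_eq_1 inner_vec_def sum_3 power2_eq_square mult_strict_mono')
    then have "(norm y)\<^sup>2 < (sin \<theta>)\<^sup>2"
      using norm_sq_plane[of y] sin_squared_eq[of \<theta>] x(2) by simp
    then have "norm y < sin \<theta>" using sin0 by (simp add: power_less_imp_less_base)
    then show "y \<in> ?B" by simp
  qed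
  have "Cn_on k (- P) (cap_density f \<theta>)"
  proof (rule Cn_on_cong[OF Pc Cn_on_const[of _ _ 0]])
    fix y assume y: "y \<in> - P"
    show "0 = cap_density f \<theta> y"
    proof (rule ccontr)
      assume "0 \<noteq> cap_density f \<theta> y"
      then have yB: "y \<in> ?B" and fy: "f (lift (vec2 y)) \<noteq> 0" by (auto simp: cap_density_def indicator_def split: if_splits)
      then have "norm (lift (vec2 y)) = 1" using nB by (intro norm_lift_vec2) (simp add: less_imp_le)
      with fy have "lift (vec2 y) \<in> K" unfolding K_def by (intro closure_subset[THEN subsetD]) simp
      then have "y \<in> P" unfolding P_def by (intro image_eqI[of _ _ "lift (vec2 y)"]) (simp_all add: lift_nth)
      with y show False by simp
    qed
  qed
  then have "Cn_on k (?B \<union> - P) (cap_density f \<theta>)" by (intro Cn_on_Un onB Pc) simp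
  moreover have "?B \<union> - P = UNIV" using PB by auto
  ultimately show ?thesis by simp
qed

section \<open>The backprojection as a logarithmic potential\<close>

lemma lborel_integrable_translate:
  fixes f :: "'a::euclidean_space \<Rightarrow> real"
  assumes "f \<in> borel_measurable borel"
  shows "integrable lborel (\<lambda>z. f (c + z)) \<longleftrightarrow> integrable lborel f"
  using integrable_distr_eq[of "(+) c" lborel borel f] assms by (simp add: lborel_distr_plus)

text \<open>The chord from \<open>x\<close> to \<open>y\<close> is less steep than the tangent cone at the boundary of the cap.\<close>
lemma cap_slope:
  fixes x y :: "real^3"
  assumes \<theta>: "0 < \<theta>" "\<theta> \<le> pi / 2" and x: "norm x = 1" "cos \<theta> \<le> x $ 3" and y: "norm y = 1" "cos \<theta> \<le> y $ 3"
  shows "\<bar>cos \<theta> * (y $ 3 - x $ 3)\<bar> \<le> sin \<theta> * norm (y $ 1 - x $ 1, y $ 2 - x $ 2)"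
proof -
  have cos0: "0 \<le> cos \<theta>" using \<theta> by (intro cos_ge_zero) auto
  have sin0: "0 < sin \<theta>" using \<theta> by (intro sin_gt_zero) auto
  define a b where "a = norm (x$1, x$2)" and "b = norm (y$1, y$2)"
  define d where "d = norm (y $ 1 - x $ 1, y $ 2 - x $ 2)"
  have sq: "a\<^sup>2 + (x$3)\<^sup>2 = 1" "b\<^sup>2 + (y$3)\<^sup>2 = 1"
    using x(1) y(1) unfolding a_def b_def norm_sq_plane
    by (simp_all add: norm_eq_1 inner_vec_def sum_3 power2_eq_square)
  have nn: "0 \<le> a" "0 \<le> b" "0 \<le> d" by (simp_all add: a_def b_def d_def)
  have ab: "a \<le> sin \<theta>" "b \<le> sin \<theta>"
  proof -
    have "(cos \<theta>)\<^sup>2 \<le> (x$3)\<^sup>2" "(cos \<theta>)\<^sup>2 \<le> (y$3)\<^sup>2" using x(2) y(2) cos0 by (simp_all add: power_mono)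
    then have "a\<^sup>2 \<le> (sin \<theta>)\<^sup>2" "b\<^sup>2 \<le> (sin \<theta>)\<^sup>2" using sq sin_squared_eq[of \<theta>] by simp_all
    then show "a \<le> sin \<theta>" "b \<le> sin \<theta>" using sin0 by (auto intro: power2_le_imp_le)
  qed
  have bad: "\<bar>b - a\<bar> \<le> d"
    using norm_triangle_ineq3[of "(y$1, y$2)" "(x$1, x$2)"] by (simp add: a_def b_def d_def)
  \<comment> \<open>On the unit sphere the difference of squared heights is minus the difference of
    squared distances \<open>a\<close>, \<open>b\<close> from the axis. Both factor; the heights sum
    to at least \<open>2 * cos \<theta>\<close>, and the distances to at most
    \<open>2 * sin \<theta>\<close>.\<close>
  have "(y$3 - x$3) * (y$3 + x$3) = - ((b - a) * (b + a))" using sq by (simp add: algebra_simps power2_eq_square)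
  then have "\<bar>(y$3 - x$3) * (y$3 + x$3)\<bar> = \<bar>(b - a) * (b + a)\<bar>" by simp
  moreover have "\<bar>y$3 + x$3\<bar> = y$3 + x$3" "\<bar>b + a\<bar> = b + a" using x(2) y(2) cos0 nn by auto
  ultimately have "\<bar>y$3 - x$3\<bar> * (y$3 + x$3) = \<bar>b - a\<bar> * (b + a)" by (simp only: abs_mult)
  also have "\<dots> \<le> d * (2 * sin \<theta>)" using bad ab nn by (intro mult_mono) auto
  finally have le: "\<bar>y$3 - x$3\<bar> * (y$3 + x$3) \<le> d * (2 * sin \<theta>)" .
  have "\<bar>y$3 - x$3\<bar> * (2 * cos \<theta>) \<le> \<bar>y$3 - x$3\<bar> * (y$3 + x$3)"
    using x(2) y(2) by (intro mult_left_mono) auto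
  then have "\<bar>y$3 - x$3\<bar> * cos \<theta> \<le> d * sin \<theta>" using le by simp
  then show ?thesis using cos0 by (simp add: abs_mult d_def mult.commute)
qed

text \<open>Replaces the absolute value of a logarithm by the signed logarithm, whose mean is known
  exactly. The range up to 2 is that of the difference of two inner products of unit
  vectors.\<close>

lemma abs_ln_le: "0 \<le> s \<Longrightarrow> s \<le> 2 \<Longrightarrow> \<bar>ln s\<bar> \<le> 2 * ln 2 - ln s" for s :: real
proof (cases "s = 0")
  case False
  assume "0 \<le> s" "s \<le> 2"
  then have "ln s \<le> ln 2" using False by (subst ln_le_cancel_iff) auto
  moreover have "0 \<le> ln (2::real)" by simp
  ultimately show ?thesis by linarith
qed simp

text \<open>The order of integration is exchanged so that, for fixed \<open>y\<close>, the logarithm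
  is averaged over the boundary circle first. The slope bound for the cap places that average in the
  range where it depends only on the planar distance. For this \<open>p\<close> has to lie in the
  disc below the cap.\<close>

lemma backprojection_eq_log_potential:
  fixes f :: "real^3 \<Rightarrow> real"
  assumes \<theta>: "0 < \<theta>" "\<theta> \<le> pi / 2" and f: "continuous_on (sphere 0 1) f"
    and supp: "\<And>y. norm y = 1 \<Longrightarrow> y $ 3 \<le> cos \<theta> \<Longrightarrow> f y = 0"
    and cont: "continuous_on UNIV (cap_density f \<theta>)"
    and p: "norm (pair2 p) < sin \<theta>"
  shows "circle_int (\<lambda>\<xi>. integral {-1..1} (\<lambda>\<tau>. Mf f \<xi> \<tau> * ln \<bar>\<tau> - \<xi> \<bullet> lift p\<bar>)) (cos \<theta> *\<^sub>R e3) e3 (sin \<theta>) =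
    sin \<theta> * (\<integral>y. cap_density f \<theta> y * ln (norm (y - pair2 p)) \<partial>lborel) +
    sin \<theta> * ((ln (sin \<theta>) - ln 2 + ln_sin_mean / pi) * (\<integral>y. cap_density f \<theta> y \<partial>lborel))"
proof -
  define F where "F = cap_density f \<theta>"
  define q where "q = pair2 p"
  define x where "x = lift p"
  have cos0: "0 \<le> cos \<theta>" using \<theta> by (intro cos_ge_zero) auto
  have sin0: "0 < sin \<theta>" using \<theta> by (intro sin_gt_zero) auto
  have contF: "continuous_on UNIV F" using cont by (simp add: F_def)
  have F0: "F y = 0" if "norm y > sin \<theta>" for y using that by (simp add: F_def cap_density_def)
  have Fm: "F \<in> borel_measurable borel" using contF by (rule borel_measurable_continuous_onI)
  have lift3: "norm (lift (vec2 y)) = 1" "cos \<theta> \<le> lift (vec2 y) $ 3" if "norm y < sin \<theta>" for y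
  proof -
    show "norm (lift (vec2 y)) = 1" using that sin_le_one[of \<theta>] by (intro norm_lift_vec2) (simp del: sin_le_one)
    have "(norm y)\<^sup>2 \<le> (sin \<theta>)\<^sup>2" using that by (intro power_mono) auto
    then have "(cos \<theta>)\<^sup>2 \<le> 1 - ((fst y)\<^sup>2 + (snd y)\<^sup>2)" by (simp add: norm_sq_plane cos_squared_eq)
    then show "cos \<theta> \<le> lift (vec2 y) $ 3" by (simp add: lift_nth real_le_rsqrt)
  qed
  have x: "norm x = 1" "cos \<theta> \<le> x $ 3" "x $ 1 = fst q" "x $ 2 = snd q"
    using lift3[OF p] unfolding vec2_pair2 x_def[symmetric] by (simp_all add: x_def lift_nth q_def pair2_def)
  have e3: "norm e3 = 1" by (simp add: e3_def)
  obtain u v where fr: "is_frame e3 u v" and circ: "\<forall>g c r. circle_int g c e3 r =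
      integral {0..2*pi} (\<lambda>t. g (c + (r * cos t) *\<^sub>R u + (r * sin t) *\<^sub>R v) * r)"
    using circle_int_frame[OF e3] by blast
  define \<xi> where "\<xi> t = cos \<theta> *\<^sub>R e3 + (sin \<theta> * cos t) *\<^sub>R u + (sin \<theta> * sin t) *\<^sub>R v" for t
  have \<xi>_sph: "\<xi> t = sph e3 u v (cos \<theta>, t)" for t
    using sin0 by (simp add: \<xi>_def sph_def sin_squared_eq[symmetric])
  have n\<xi>: "norm (\<xi> t) = 1" for t unfolding \<xi>_sph by (rule norm_sph[OF fr]) simp
  have dot3: "w \<bullet> e3 = w $ 3" for w :: "real^3" by (simp add: e3_def inner_axis)
  have \<xi>3: "\<xi> t $ 3 = cos \<theta>" for t
    using sph_inner(1)[OF fr, of "(cos \<theta>, t)"] by (simp add: \<xi>_sph dot3)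
  have \<xi>dot: "\<xi> t \<bullet> w = cos \<theta> * w $ 3 + (sin \<theta> * (u \<bullet> w)) * cos t + (sin \<theta> * (v \<bullet> w)) * sin t" for t w
    using dot3[of w] by (simp add: \<xi>_def inner_add_left inner_commute[of e3] algebra_simps)
  define \<Phi> where "\<Phi> z = indicator {0..2*pi} (snd z) * (F (fst z) * ln \<bar>\<xi> (snd z) \<bullet> lift (vec2 (fst z)) - \<xi> (snd z) \<bullet> x\<bar>)"
    for z :: "(real \<times> real) \<times> real"
  have inner: "2 * pi * integral {-1..1} (\<lambda>\<tau>. Mf f (\<xi> t) \<tau> * ln \<bar>\<tau> - \<xi> t \<bullet> x\<bar>) =
      (\<integral>y. F y * ln \<bar>\<xi> t \<bullet> lift (vec2 y) - \<xi> t \<bullet> x\<bar> \<partial>lborel)" for t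
    using mean_ln_integral(2)[OF \<theta> n\<xi> \<xi>3 f supp, of t "\<xi> t \<bullet> x"] by (simp add: F_def cap_density_def mult.assoc)
  have trig: "integrable lborel (\<lambda>t. indicator {0..2*pi} t * ln \<bar>\<xi> t \<bullet> lift (vec2 y) - \<xi> t \<bullet> x\<bar>)"
    "(\<integral>t. indicator {0..2*pi} t * ln \<bar>\<xi> t \<bullet> lift (vec2 y) - \<xi> t \<bullet> x\<bar> \<partial>lborel) =
       2 * pi * (ln (sin \<theta>) + ln (norm (y - q)) - ln 2) + 2 * ln_sin_mean"
    if y: "norm y < sin \<theta>" "y \<noteq> q" for y
  proof -
    define w where "w = lift (vec2 y) - x"
    have w12: "w $ 1 = fst y - fst q" "w $ 2 = snd y - snd q" using x by (simp_all add: w_def lift_nth)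
    have yq: "y - q = (w $ 1, w $ 2)" using w12 by (simp add: prod_eq_iff)
    define A where "A = sin \<theta> * norm (y - q)"
    have A: "A > 0" using y sin0 by (simp add: A_def)
    have "(u \<bullet> w)\<^sup>2 + (v \<bullet> w)\<^sup>2 = (w $ 1)\<^sup>2 + (w $ 2)\<^sup>2"
    proof -
      have "w \<bullet> w = (w $ 1)\<^sup>2 + (w $ 2)\<^sup>2 + (w $ 3)\<^sup>2"
        by (simp add: inner_vec_def sum_3 power2_eq_square)
      then show ?thesis
        using frame_norm[OF fr, of w] unfolding dot3 inner_commute[of w u] inner_commute[of w v] by simp
    qed
    then have A2: "A\<^sup>2 = (sin \<theta> * (u \<bullet> w))\<^sup>2 + (sin \<theta> * (v \<bullet> w))\<^sup>2"
      unfolding A_def power_mult_distrib norm_sq_plane yq by (simp add: distrib_left[symmetric])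
    \<comment> \<open>The constant term of the trigonometric polynomial is the height difference
      times \<open>cos \<theta>\<close>; the slope bound is exactly the amplitude condition.\<close>
    have le: "\<bar>cos \<theta> * w $ 3\<bar> \<le> A"
      using cap_slope[OF \<theta> x(1,2) lift3[OF y(1)]] by (simp add: A_def yq w_def)
    have eq: "\<xi> t \<bullet> lift (vec2 y) - \<xi> t \<bullet> x = cos \<theta> * w $ 3 + (sin \<theta> * (u \<bullet> w)) * cos t + (sin \<theta> * (v \<bullet> w)) * sin t" for t
      unfolding inner_diff_right[symmetric] w_def[symmetric] by (rule \<xi>dot)
    note T = ln_linear_trig_integral[OF A A2 le, folded eq]
    show "integrable lborel (\<lambda>t. indicator {0..2*pi} t * ln \<bar>\<xi> t \<bullet> lift (vec2 y) - \<xi> t \<bullet> x\<bar>)" by (rule T(1))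
    have "ln A = ln (sin \<theta>) + ln (norm (y - q))" unfolding A_def using sin0 y by (intro ln_mult_pos) auto
    then show "(\<integral>t. indicator {0..2*pi} t * ln \<bar>\<xi> t \<bullet> lift (vec2 y) - \<xi> t \<bullet> x\<bar> \<partial>lborel) =
       2 * pi * (ln (sin \<theta>) + ln (norm (y - q)) - ln 2) + 2 * ln_sin_mean" using T(2) by simp
  qed
  \<comment> \<open>The part of the circle average, after division by \<open>2 * pi\<close>, that
    does not depend on \<open>y\<close>: \<open>ln (sin \<theta>)\<close> comes from the amplitude,
    \<open>- ln 2\<close> and \<open>ln_sin_mean / pi\<close> from the two half-angle
    factors.\<close>
  define c where "c = ln (sin \<theta>) - ln 2 + ln_sin_mean / pi"
  have \<Phi>_section: "integrable lborel (\<lambda>t. \<Phi> (y, t))"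
      "(\<integral>t. \<Phi> (y, t) \<partial>lborel) = 2 * pi * (F y * ln (norm (y - q)) + c * F y)"
    if "y \<noteq> q" for y
  proof -
    have \<Phi>eq: "\<Phi> (y, t) = F y * (indicator {0..2*pi} t * ln \<bar>\<xi> t \<bullet> lift (vec2 y) - \<xi> t \<bullet> x\<bar>)" for t
      by (simp add: \<Phi>_def)
    have "integrable lborel (\<lambda>t. \<Phi> (y, t)) \<and> (\<integral>t. \<Phi> (y, t) \<partial>lborel) = 2 * pi * (F y * ln (norm (y - q)) + c * F y)"
    proof (cases "norm y < sin \<theta>")
      case True
      note T = trig[OF True that]
      have "(\<integral>t. \<Phi> (y, t) \<partial>lborel) = F y * (2 * pi * (ln (sin \<theta>) + ln (norm (y - q)) - ln 2) + 2 * ln_sin_mean)"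
        unfolding \<Phi>eq using T(2) by simp
      also have "\<dots> = 2 * pi * (F y * ln (norm (y - q)) + c * F y)"
        by (simp add: c_def field_simps)
      finally show ?thesis unfolding \<Phi>eq using T(1) by simp
    next
      case False
      then have "F y = 0" by (simp add: F_def cap_density_def)
      then show ?thesis unfolding \<Phi>eq by simp
    qed
    then show "integrable lborel (\<lambda>t. \<Phi> (y, t))"
      "(\<integral>t. \<Phi> (y, t) \<partial>lborel) = 2 * pi * (F y * ln (norm (y - q)) + c * F y)" by auto
  qed
  have potm: "(\<lambda>y. F y * ln (norm (y - q))) \<in> borel_measurable borel"
    by (intro borel_measurable_times Fm borel_measurable_ln borel_measurable_continuous_onI continuous_intros)
  have poti: "integrable lborel (\<lambda>y. F y * ln (norm (y - q)))"
    using integrable_log_potential[OF contF F0, where p=q] lborel_integrable_translate[OF potm, of q] by simp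
  have Fi: "integrable lborel F"
  proof -
    have "integrable lborel (\<lambda>y. indicator (cball 0 (sin \<theta>)) y *\<^sub>R F y)"
      by (rule borel_integrable_compact) (auto intro: continuous_on_subset[OF contF])
    moreover have "(\<lambda>y. indicator (cball 0 (sin \<theta>)) y *\<^sub>R F y) = F"
      using F0 by (auto simp: indicator_def fun_eq_iff not_le)
    ultimately show ?thesis by simp
  qed
  have AEq: "AE y in lborel. y \<noteq> q" by (rule AE_lborel_singleton)
  have \<Phi>m: "\<Phi> \<in> borel_measurable (lborel \<Otimes>\<^sub>M lborel)"
  proof -
    have cs: "continuous_on UNIV (\<lambda>z :: (real \<times> real) \<times> real. snd z)" and cf: "continuous_on UNIV (\<lambda>z :: (real \<times> real) \<times> real. fst z)"
      by (intro continuous_intros)+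
    have m1: "(\<lambda>z :: (real \<times> real) \<times> real. indicator {0..2*pi} (snd z) :: real) \<in> borel_measurable borel"
      by (rule measurable_compose[OF borel_measurable_continuous_onI[OF cs]]) simp
    have m2: "(\<lambda>z :: (real \<times> real) \<times> real. F (fst z)) \<in> borel_measurable borel"
      by (rule measurable_compose[OF borel_measurable_continuous_onI[OF cf] Fm])
    have "continuous_on UNIV (\<lambda>z :: (real \<times> real) \<times> real. \<bar>\<xi> (snd z) \<bullet> lift (vec2 (fst z)) - \<xi> (snd z) \<bullet> x\<bar>)"
      unfolding \<xi>_def
      by (intro continuous_intros continuous_on_compose2[OF continuous_on_lift_vec2[of UNIV] cf]) auto
    from borel_measurable_times[OF m1 borel_measurable_times[OF m2 borel_measurable_ln[OF borel_measurable_continuous_onI[OF this]]]]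
    have "\<Phi> \<in> borel_measurable borel" unfolding \<Phi>_def .
    then show ?thesis unfolding lborel_prod by simp
  qed
  have \<Phi>i: "integrable (lborel \<Otimes>\<^sub>M lborel) \<Phi>"
  proof (rule lborel_pair.Fubini_integrable[OF \<Phi>m])
    show "AE y in lborel. integrable lborel (\<lambda>t. \<Phi> (y, t))"
      using AEq by eventually_elim (rule \<Phi>_section(1))
    show "integrable lborel (\<lambda>y. \<integral>t. norm (\<Phi> (y, t)) \<partial>lborel)"
    proof (rule Bochner_Integration.integrable_bound)
      let ?b = "\<lambda>y. (4 * pi * ln 2) * \<bar>F y\<bar> + (2 * pi) * (\<bar>F y * ln (norm (y - q))\<bar> + \<bar>c\<bar> * \<bar>F y\<bar>)"
      show "integrable lborel ?b"
        by (intro Bochner_Integration.integrable_add integrable_mult_right integrable_abs poti Fi)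
      show "(\<lambda>y. \<integral>t. norm (\<Phi> (y, t)) \<partial>lborel) \<in> borel_measurable lborel"
        using \<Phi>m by measurable
      show "AE y in lborel. norm (\<integral>t. norm (\<Phi> (y, t)) \<partial>lborel) \<le> norm (?b y)"
        using AEq
      proof eventually_elim
        case (elim y)
        note S = \<Phi>_section[OF elim]
        \<comment> \<open>Multiplying by the sign of \<open>F y\<close> turns the bound for the
          absolute logarithm into one whose right-hand side integrates exactly. The integral of the
          norm is thus controlled by the signed integral \<open>\<Phi>_section\<close>.\<close>
        have pw: "norm (\<Phi> (y, t)) \<le> (2 * ln 2 * \<bar>F y\<bar>) * indicator {0..2*pi} t - sgn (F y) * \<Phi> (y, t)" for t
        proof (cases "t \<in> {0..2*pi} \<and> norm y < sin \<theta>")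
          case True
          define s where "s = \<bar>\<xi> t \<bullet> lift (vec2 y) - \<xi> t \<bullet> x\<bar>"
          have "\<bar>\<xi> t \<bullet> lift (vec2 y)\<bar> \<le> 1" "\<bar>\<xi> t \<bullet> x\<bar> \<le> 1"
            using Cauchy_Schwarz_ineq2[of "\<xi> t" "lift (vec2 y)"] Cauchy_Schwarz_ineq2[of "\<xi> t" x] True n\<xi> lift3(1)[of y] x(1)
            by simp_all
          then have "s \<le> 2" unfolding s_def by linarith
          then have ls: "\<bar>ln s\<bar> \<le> 2 * ln 2 - ln s" by (intro abs_ln_le) (simp_all add: s_def)
          have "\<bar>F y\<bar> * \<bar>ln s\<bar> \<le> \<bar>F y\<bar> * (2 * ln 2 - ln s)" by (rule mult_left_mono[OF ls]) simp
          moreover have P: "\<Phi> (y, t) = F y * ln s" using True by (simp add: \<Phi>_def s_def)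
          moreover have sg: "sgn (F y) * (F y * ln s) = \<bar>F y\<bar> * ln s" 
            by (cases "F y" "0::real" rule: linorder_cases) auto
          moreover have ind: "indicator {0..2*pi} t = (1::real)" using True by simp
          ultimately show ?thesis unfolding P sg ind real_norm_def abs_mult by (simp add: algebra_simps)
        next
          case False
          then have "\<Phi> (y, t) = 0" by (auto simp: \<Phi>_def F_def cap_density_def)
          then show ?thesis by simp
        qed
        have i2: "integrable lborel (\<lambda>t. (2 * ln 2 * \<bar>F y\<bar>) * indicator {0..2*pi} t :: real)"
          by (intro integrable_mult_right integrable_real_indicator) (auto simp: emeasure_lborel_Icc_eq)
        have i3: "integrable lborel (\<lambda>t. sgn (F y) * \<Phi> (y, t))" by (intro integrable_mult_right S(1))
        have "(\<integral>t. norm (\<Phi> (y, t)) \<partial>lborel) \<le> (\<integral>t. (2 * ln 2 * \<bar>F y\<bar>) * indicator {0..2*pi} t - sgn (F y) * \<Phi> (y, t) \<partial>lborel)"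
          by (intro integral_mono pw integrable_norm S(1) Bochner_Integration.integrable_diff i2 i3)
        also have "\<dots> = (\<integral>t. (2 * ln 2 * \<bar>F y\<bar>) * indicator {0..2*pi} t \<partial>lborel) - (\<integral>t. sgn (F y) * \<Phi> (y, t) \<partial>lborel)"
          by (rule Bochner_Integration.integral_diff[OF i2 i3])
        also have "\<dots> = (4 * pi * ln 2) * \<bar>F y\<bar> - sgn (F y) * (2 * pi * (F y * ln (norm (y - q)) + c * F y))"
          using S(2) by simp
        also have "\<dots> \<le> ?b y"
        proof -
          have "- (sgn (F y) * (2 * pi * (F y * ln (norm (y - q)) + c * F y))) \<le>
              \<bar>sgn (F y) * (2 * pi * (F y * ln (norm (y - q)) + c * F y))\<bar>" by (rule abs_ge_minus_self)
          also have "\<dots> \<le> 1 * \<bar>2 * pi * (F y * ln (norm (y - q)) + c * F y)\<bar>"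
            unfolding abs_mult[of "sgn (F y)"] by (intro mult_right_mono) (auto simp: abs_sgn_eq)
          also have "\<dots> = 2 * pi * \<bar>F y * ln (norm (y - q)) + c * F y\<bar>" by (simp add: abs_mult)
          also have "\<dots> \<le> 2 * pi * (\<bar>F y * ln (norm (y - q))\<bar> + \<bar>c\<bar> * \<bar>F y\<bar>)"
            using abs_triangle_ineq[of "F y * ln (norm (y - q))" "c * F y"] by (intro mult_left_mono) (simp_all add: abs_mult)
          finally show ?thesis unfolding diff_conv_add_uminus by (rule add_left_mono)
        qed
        finally have "(\<integral>t. norm (\<Phi> (y, t)) \<partial>lborel) \<le> ?b y" .
        moreover have "0 \<le> (\<integral>t. norm (\<Phi> (y, t)) \<partial>lborel)" by (rule Bochner_Integration.integral_nonneg) simp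
        ultimately have "\<bar>\<integral>t. norm (\<Phi> (y, t)) \<partial>lborel\<bar> \<le> ?b y" by (simp only: abs_of_nonneg)
        then show ?case unfolding real_norm_def by (rule order_trans[OF _ abs_ge_self])
      qed
    qed
  qed
  have "(\<integral>t. (\<integral>y. \<Phi> (y, t) \<partial>lborel) \<partial>lborel) = (\<integral>y. (\<integral>t. \<Phi> (y, t) \<partial>lborel) \<partial>lborel)"
    using lborel_pair.Fubini_integral[of "\<lambda>y t. \<Phi> (y, t)"] \<Phi>i by simp
  also have "\<dots> = (\<integral>y. 2 * pi * (F y * ln (norm (y - q)) + c * F y) \<partial>lborel)"
  proof (rule integral_cong_AE)
    show "(\<lambda>y. \<integral>t. \<Phi> (y, t) \<partial>lborel) \<in> borel_measurable lborel" using \<Phi>m by measurable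
    show "(\<lambda>y. 2 * pi * (F y * ln (norm (y - q)) + c * F y)) \<in> borel_measurable lborel"
      using potm Fm by simp
    show "AE y in lborel. (\<integral>t. \<Phi> (y, t) \<partial>lborel) = 2 * pi * (F y * ln (norm (y - q)) + c * F y)"
      using AEq by eventually_elim (rule \<Phi>_section(2))
  qed
  also have "\<dots> = 2 * pi * ((\<integral>y. F y * ln (norm (y - q)) \<partial>lborel) + c * (\<integral>y. F y \<partial>lborel))"
    using poti Fi by simp
  finally have total: "(\<integral>t. (\<integral>y. \<Phi> (y, t) \<partial>lborel) \<partial>lborel) =
      2 * pi * ((\<integral>y. F y * ln (norm (y - q)) \<partial>lborel) + c * (\<integral>y. F y \<partial>lborel))" .
  define J where "J t = (\<integral>y. F y * ln \<bar>\<xi> t \<bullet> lift (vec2 y) - \<xi> t \<bullet> x\<bar> \<partial>lborel)" for t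
  have J: "(\<integral>y. \<Phi> (y, t) \<partial>lborel) = indicator {0..2*pi} t * J t" for t by (simp add: \<Phi>_def J_def)
  have "integrable lborel (\<lambda>t. \<integral>y. \<Phi> (y, t) \<partial>lborel)"
    using lborel_pair.integrable_snd[of "\<lambda>y t. \<Phi> (y, t)"] \<Phi>i by simp
  then have "set_integrable lborel {0..2*pi} J" unfolding J set_integrable_def by simp
  from set_borel_integral_eq_integral(2)[OF this]
  have JHK: "integral {0..2*pi} J = (\<integral>t. (\<integral>y. \<Phi> (y, t) \<partial>lborel) \<partial>lborel)"
    by (simp add: J set_lebesgue_integral_def)
  \<comment> \<open>\<open>sin \<theta>\<close> is the radius factor in \<open>circle_int\<close>,
    and \<open>1 / (2 * pi)\<close> the normalisation of \<open>Mf\<close>; the latter will cancel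
    the length of the angular interval.\<close>
  have inner': "integral {-1..1} (\<lambda>\<tau>. Mf f (\<xi> t) \<tau> * ln \<bar>\<tau> - \<xi> t \<bullet> x\<bar>) * sin \<theta> = (sin \<theta> / (2 * pi)) * J t" for t
    using inner[of t, folded J_def] by (simp add: field_simps)
  have "circle_int (\<lambda>\<xi>. integral {-1..1} (\<lambda>\<tau>. Mf f \<xi> \<tau> * ln \<bar>\<tau> - \<xi> \<bullet> lift p\<bar>)) (cos \<theta> *\<^sub>R e3) e3 (sin \<theta>) =
      integral {0..2*pi} (\<lambda>t. (sin \<theta> / (2 * pi)) * J t)"
    unfolding circ[rule_format] \<xi>_def[symmetric] x_def[symmetric] inner' ..
  also have "\<dots> = sin \<theta> / (2 * pi) * integral {0..2*pi} J" by simp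
  also have "\<dots> = sin \<theta> * (\<integral>y. F y * ln (norm (y - q)) \<partial>lborel) + sin \<theta> * (c * (\<integral>y. F y \<partial>lborel))"
    unfolding JHK total by (simp add: distrib_left)
  finally show ?thesis by (simp only: F_def q_def c_def)
qed

theorem theorem5p5:
  fixes f :: "real^3 \<Rightarrow> real" and \<theta> :: real and x :: "real^3"
  assumes "0 < \<theta>" and "\<theta> \<le> pi/2"
    and "smooth_on_sphere f"
    and "closure {y \<in> sphere 0 1. f y \<noteq> 0} \<subseteq> cap \<theta>"
    and "x \<in> cap \<theta>"
  shows "\<exists>L. has_laplacian
              (\<lambda>p. circle_int
                     (\<lambda>\<xi>. integral {-1..1} (\<lambda>\<tau>. Mf f \<xi> \<tau> * ln \<bar>\<tau> - \<xi> \<bullet> lift p\<bar>))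
                     (cos \<theta> *\<^sub>R e3) e3 (sin \<theta>))
              (proj x) L
         \<and> f x = x$3 / (2 * pi * sin \<theta>) * L"
proof -
  have cos0: "0 \<le> cos \<theta>" using assms(1,2) by (intro cos_ge_zero) auto
  have sin0: "0 < sin \<theta>" using assms(1,2) by (intro sin_gt_zero) auto
  obtain U F where U: "sphere 0 1 \<subseteq> U" "smooth_on U F" "\<forall>y\<in>sphere 0 1. F y = f y"
    using assms(3) unfolding smooth_on_sphere_def by blast
  have "continuous_on U F" using U(2) unfolding smooth_on_def by (metis Cn_on.simps(1))
  then have "continuous_on (sphere 0 1) F" using U(1) by (rule continuous_on_subset)
  then have f: "continuous_on (sphere 0 1) f" by (rule continuous_on_eq) (use U(3) in blast)
  have supp: "f y = 0" if "norm y = 1" "y $ 3 \<le> cos \<theta>" for y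
  proof (rule ccontr)
    assume "f y \<noteq> 0"
    then have "y \<in> closure {y \<in> sphere 0 1. f y \<noteq> 0}"
      using that by (intro closure_subset[THEN subsetD]) simp
    then show False using assms(4) that by (auto simp: mem_cap_iff)
  qed
  note C = Cn_on_cap_density[OF assms(1-4)]
  have cont: "continuous_on UNIV (cap_density f \<theta>)" using C[of 0] by simp
  have x: "norm x = 1" "cos \<theta> < x $ 3" using assms(5) by (simp_all add: mem_cap_iff)
  have proj: "proj x $ 1 = x $ 1" "proj x $ 2 = x $ 2" by (simp_all add: proj_def)
  have lift: "lift (proj x) = x" using x cos0 proj by (intro lift_proj) auto
  have "(x$1)\<^sup>2 + (x$2)\<^sup>2 + (x$3)\<^sup>2 = 1"
    using x(1) by (simp add: norm_eq_1 inner_vec_def sum_3 power2_eq_square)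
  moreover have "(cos \<theta>)\<^sup>2 < (x$3)\<^sup>2" using x(2) cos0 by (intro power_strict_mono) auto
  ultimately have "(norm (pair2 (proj x)))\<^sup>2 < (sin \<theta>)\<^sup>2"
    unfolding norm_sq_plane using sin_squared_eq[of \<theta>] by (simp add: pair2_def proj)
  then have px: "norm (pair2 (proj x)) < sin \<theta>" 
    by (rule power_less_imp_less_base) (use sin0 in simp)
  \<comment> \<open>An open neighbourhood of \<open>proj x\<close> on which the backprojection is an
    affine function of the potential.\<close>
  define A where "A = {p. norm (pair2 p) < sin \<theta>}"
  have "open A" unfolding A_def
    by (rule open_Collect_less[OF continuous_on_norm[OF linear_continuous_on[OF bounded_linear_pair2]] continuous_on_const])
  moreover have "proj x \<in> A" using px by (simp add: A_def)
  ultimately have "has_laplacian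
              (\<lambda>p. circle_int
                     (\<lambda>\<xi>. integral {-1..1} (\<lambda>\<tau>. Mf f \<xi> \<tau> * ln \<bar>\<tau> - \<xi> \<bullet> lift p\<bar>))
                     (cos \<theta> *\<^sub>R e3) e3 (sin \<theta>))
              (proj x) (sin \<theta> * (2 * pi * cap_density f \<theta> (pair2 (proj x))))"
  proof (rule has_laplacian_affine_transform)
    fix p assume "p \<in> A"
    then have "norm (pair2 p) < sin \<theta>" by (simp add: A_def)
    then show "circle_int (\<lambda>\<xi>. integral {-1..1} (\<lambda>\<tau>. Mf f \<xi> \<tau> * ln \<bar>\<tau> - \<xi> \<bullet> lift p\<bar>)) (cos \<theta> *\<^sub>R e3) e3 (sin \<theta>) =
      sin \<theta> * (\<integral>y. cap_density f \<theta> y * ln (norm (y - pair2 p)) \<partial>lborel) +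
      sin \<theta> * ((ln (sin \<theta>) - ln 2 + ln_sin_mean / pi) * (\<integral>y. cap_density f \<theta> y \<partial>lborel))"
      by (intro backprojection_eq_log_potential assms(1,2) f supp cont)
  next
    show "has_laplacian (\<lambda>p. \<integral>y. cap_density f \<theta> y * ln (norm (y - pair2 p)) \<partial>lborel) (proj x)
        (2 * pi * cap_density f \<theta> (pair2 (proj x)))"
      by (rule has_laplacian_log_potential[OF C, of "sin \<theta>"]) (simp add: cap_density_def)
  qed
  \<comment> \<open>The prefactor undoes three factors: \<open>2 * pi\<close> of the fundamental
    solution, \<open>sin \<theta>\<close> of the arc length, and \<open>1 / x $ 3\<close> of the
    projected surface measure.\<close>
  moreover have "f x = x$3 / (2 * pi * sin \<theta>) * (sin \<theta> * (2 * pi * cap_density f \<theta> (pair2 (proj x))))"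
  proof -
    have "cap_density f \<theta> (pair2 (proj x)) = f x / x $ 3" using px by (simp add: cap_density_def lift)
    then show ?thesis using x(2) cos0 sin0 by simp
  qed
  ultimately show ?thesis by blast
qed

end
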